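(* Consider the output estimation (OE) instance with $n=m=p=2$ given by $A=-I_2$, $C=I_2$, $W_1=3I_2$, $W_2=I_2$, $G=I_2$, and, for $\gamma>0$, the filter $\mathsf K_{\mathrm{bad}}=(A_{\mathrm{bad}},B_{\mathrm{bad}},C_{\mathrm{bad}})$, $$A_{\mathrm{bad}}=\begin{bmatrix}-2&0\\ \gamma&-\gamma\end{bmatrix},\qquad B_{\mathrm{bad}}=\begin{bmatrix}1&0\\0&0\end{bmatrix},\qquad C_{\mathrm{bad}}=\begin{bmatrix}1&0\\0&0\end{bmatrix}.$$ For any $\gamma>0$ the following are true: (i) the instance satisfies assumptions (S1)-(S4) of the context; (ii) $\mathsf K_{\mathrm{bad}}\in\mathcal K_{\mathrm{stab}}$; (iii) $\mathsf K_{\mathrm{bad}}$ is a first-order critical point: $\nabla\mathcal L_{\mathrm{OE}}(\mathsf K_{\mathrm{bad}})=0$; (iv) the filter is strictly suboptimal: $\mathsf K_{\mathrm{bad}}\notin\mathcal K_{\mathrm{opt}}$; (v) $\mathsf K_{\mathrm{bad}}$ is controllable: $\mathsf K_{\mathrm{bad}}\in\mathcal K_{\mathrm{ctrb}}$, i.e. $\Sigma_{22,\mathsf K_{\mathrm{bad}}}\succ0$; (vi) $\Sigma_{12,\mathsf K_{\mathrm{bad}}}$ is not full rank. Moreover, $\mathcal L_{\mathrm{OE}}(\mathsf K_{\mathrm{bad}})$ does not depend on $\gamma$, showing that $\mathcal L_{\mathrm{OE}}$ does not have compact level sets.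
   Context: Output estimation (OE) problem. Given $A\in\mathbb R^{n\times n}$, $C\in\mathbb R^{m\times n}$, $G\in\mathbb R^{p\times n}$, and symmetric $W_1\in\mathbb R^{n\times n}$, $W_2\in\mathbb R^{m\times m}$, the true system is $\dot x(t)=Ax(t)+w(t)$, $y(t)=Cx(t)+v(t)$, $z(t)=Gx(t)$, $x(0)=0$, where $w,v$ are independent white Gaussian noises with intensities $W_1,W_2$. A filter is a triple $\mathsf K=(A_{\mathsf K},B_{\mathsf K},C_{\mathsf K})\in\mathbb R^{n\times n}\times\mathbb R^{n\times m}\times\mathbb R^{p\times n}$, with dynamics $\dot{\hat x}(t)=A_{\mathsf K}\hat x(t)+B_{\mathsf K}y(t)$, $\hat z(t)=C_{\mathsf K}\hat x(t)$. Its loss is $\mathcal L_{\mathrm{OE}}(\mathsf K)=\lim_{t\to\infty}\mathbb E\|z(t)-\hat z(t)\|^2$. $\mathcal K_{\mathrm{stab}}$ is the set of $\mathsf K$ with $A_{\mathsf K}$ Hurwitz stable. For $\mathsf K\in\mathcal K_{\mathrm{stab}}$, $\Sigma_{\mathsf K}\in\mathbb R^{2n\times 2n}$ is the stationary covariance of $(x,\hat x)$, i.e. the unique solution of $$A_{\mathrm{cl},\mathsf K}\Sigma+\Sigma A_{\mathrm{cl},\mathsf K}^\top+W_{\mathrm{cl},\mathsf K}=0,\quad A_{\mathrm{cl},\mathsf K}=\begin{bmatrix}A&0\\ B_{\mathsf K}C&A_{\mathsf K}\end{bmatrix},\quad W_{\mathrm{cl},\mathsf K}=\begin{bmatrix}W_1&0\\0&B_{\mathsf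 K}W_2B_{\mathsf K}^\top\end{bmatrix},$$ partitioned into $n\times n$ blocks $\Sigma_{\mathsf K}=\begin{bmatrix}\Sigma_{11,\mathrm{sys}}&\Sigma_{12,\mathsf K}\\ \Sigma_{12,\mathsf K}^\top&\Sigma_{22,\mathsf K}\end{bmatrix}$. Then $\mathcal L_{\mathrm{OE}}(\mathsf K)=\mathrm{tr}\big([G\ \ {-C_{\mathsf K}}]\,\Sigma_{\mathsf K}\,[G\ \ {-C_{\mathsf K}}]^\top\big)$. $\mathcal K_{\mathrm{ctrb}}=\{\mathsf K\in\mathcal K_{\mathrm{stab}}:\Sigma_{22,\mathsf K}\succ0\}$. Level sets of $\mathcal L_{\mathrm{OE}}$ are the sets $\{\mathsf K\in\mathcal K_{\mathrm{stab}}:\mathcal L_{\mathrm{OE}}(\mathsf K)\le c\}$. Let $P_\star$ be the (positive semidefinite, stabilizing) solution of $AP_\star+P_\star A^\top-P_\star C^\top W_2^{-1}CP_\star+W_1=0$, $L_\star=P_\star C^\top W_2^{-1}$; the set of optimal filters is $\mathcal K_{\mathrm{opt}}=\{(S(A-L_\star C)S^{-1},SL_\star,GS^{-1}): S\in\mathbb R^{n\times n} \text{ invertible}\}$. Assumptions: (S1) $A$ is Hurwitz stable. (S2) $(A,C)$ is observable, i.e. $\int_0^\infty e^{sA^\top}C^\top Ce^{sA}\,ds\succ0$. (S3) $W_1\succ0$ and $W_2\succ0$. (S4) For every $\mathsf K\in\mathcal K_{\mathrm{opt}}$, the pair $(A_{\mathsf K},B_{\mathsf K})$ is controllable. *)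

theory Defs
  imports "HOL-Probability.Probability"
begin

definition posdef :: "real^'n^'n \<Rightarrow> bool" where
  "posdef M \<longleftrightarrow> transpose M = M \<and> (\<forall>x. x \<noteq> 0 \<longrightarrow> 0 < x \<bullet> (M *v x))"

definition possemidef :: "real^'n^'n \<Rightarrow> bool" where
  "possemidef M \<longleftrightarrow> transpose M = M \<and> (\<forall>x. 0 \<le> x \<bullet> (M *v x))"

definition complex_eigenvalue :: "real^'n^'n \<Rightarrow> complex \<Rightarrow> bool" where
  "complex_eigenvalue M \<mu> \<longleftrightarrow>
     (\<exists>z :: complex^'n. z \<noteq> 0 \<and> map_matrix complex_of_real M *v z = \<mu> *s z)"

definition hurwitz :: "real^'n^'n \<Rightarrow> bool" where
  "hurwitz M \<longleftrightarrow> (\<forall>\<mu>. complex_eigenvalue M \<mu> \<longrightarrow> Re \<mu> < 0)"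

(* The matrix product is **, so the powers in the exponential series are iterates of it. *)
definition matrix_exp :: "real^'n^'n \<Rightarrow> real^'n^'n" where
  "matrix_exp M = (\<Sum>k. (1 / fact k) *\<^sub>R (((**) M ^^ k) (mat 1)))"

definition observable :: "real^'n^'n \<Rightarrow> real^'n^'m \<Rightarrow> bool" where
  "observable A C \<longleftrightarrow>
     (\<lambda>s. matrix_exp (s *\<^sub>R transpose A) ** transpose C ** C ** matrix_exp (s *\<^sub>R A))
       integrable_on {0..} \<and>
     posdef (integral {0..}
       (\<lambda>s. matrix_exp (s *\<^sub>R transpose A) ** transpose C ** C ** matrix_exp (s *\<^sub>R A)))"

(* As for observability, the infinite-horizon Gramian is meant for Hurwitz stable A. *)
definition controllable :: "real^'n^'n \<Rightarrow> real^'m^'n \<Rightarrow> bool" where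
  "controllable A B \<longleftrightarrow>
     (\<lambda>s. matrix_exp (s *\<^sub>R A) ** B ** transpose B ** matrix_exp (s *\<^sub>R transpose A))
       integrable_on {0..} \<and>
     posdef (integral {0..}
       (\<lambda>s. matrix_exp (s *\<^sub>R A) ** B ** transpose B ** matrix_exp (s *\<^sub>R transpose A)))"

definition block_matrix ::
  "'a^'n1^'m1 \<Rightarrow> 'a^'n2^'m1 \<Rightarrow> 'a^'n1^'m2 \<Rightarrow> 'a^'n2^'m2 \<Rightarrow> 'a^('n1 + 'n2)^('m1 + 'm2)" where
  "block_matrix P Q R S = (\<chi> i j. case i of
       Inl a \<Rightarrow> (case j of Inl b \<Rightarrow> P $ a $ b | Inr b \<Rightarrow> Q $ a $ b)
     | Inr a \<Rightarrow> (case j of Inl b \<Rightarrow> R $ a $ b | Inr b \<Rightarrow> S $ a $ b))"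

definition block12 :: "'a^('n1::finite + 'n2::finite)^('m1::finite + 'm2::finite) \<Rightarrow> 'a^'n2^'m1" where
  "block12 M = (\<chi> a b. M $ Inl a $ Inr b)"

definition block22 :: "'a^('n1::finite + 'n2::finite)^('m1::finite + 'm2::finite) \<Rightarrow> 'a^'n2^'m2" where
  "block22 M = (\<chi> a b. M $ Inr a $ Inr b)"

record ('n, 'm, 'p) oe_instance =
  sysA :: "real^'n^'n"
  sysC :: "real^'n^'m"
  sysG :: "real^'n^'p"
  covW1 :: "real^'n^'n"
  covW2 :: "real^'m^'m"

(* A filter is (AK, BK, CK). As a product of Euclidean spaces this type carries the inner product
   <AK, AK'> + <BK, BK'> + <CK, CK'> of entrywise (Frobenius) inner products. *)
type_synonym ('n, 'm, 'p) oe_filter = "(real^'n^'n) \<times> (real^'m^'n) \<times> (real^'n^'p)"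

definition K_stab :: "('n::finite, 'm::finite, 'p::finite) oe_filter set" where
  "K_stab = {(AK, BK, CK). hurwitz AK}"

definition A_cl :: "('n::finite, 'm::finite, 'p::finite) oe_instance \<Rightarrow> ('n, 'm, 'p) oe_filter
    \<Rightarrow> real^('n + 'n)^('n + 'n)" where
  "A_cl I = (\<lambda>(AK, BK, CK). block_matrix (sysA I) 0 (BK ** sysC I) AK)"

definition W_cl :: "('n::finite, 'm::finite, 'p::finite) oe_instance \<Rightarrow> ('n, 'm, 'p) oe_filter
    \<Rightarrow> real^('n + 'n)^('n + 'n)" where
  "W_cl I = (\<lambda>(AK, BK, CK). block_matrix (covW1 I) 0 0 (BK ** covW2 I ** transpose BK))"

definition Sigma_cov :: "('n::finite, 'm::finite, 'p::finite) oe_instance \<Rightarrow> ('n, 'm, 'p) oe_filter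
    \<Rightarrow> real^('n + 'n)^('n + 'n)" where
  "Sigma_cov I K = (THE S. A_cl I K ** S + S ** transpose (A_cl I K) + W_cl I K = 0)"

definition Sigma12 :: "('n::finite, 'm::finite, 'p::finite) oe_instance \<Rightarrow> ('n, 'm, 'p) oe_filter
    \<Rightarrow> real^'n^'n" where
  "Sigma12 I K = block12 (Sigma_cov I K)"

definition Sigma22 :: "('n::finite, 'm::finite, 'p::finite) oe_instance \<Rightarrow> ('n, 'm, 'p) oe_filter
    \<Rightarrow> real^'n^'n" where
  "Sigma22 I K = block22 (Sigma_cov I K)"

definition K_ctrb :: "('n::finite, 'm::finite, 'p::finite) oe_instance
    \<Rightarrow> ('n, 'm, 'p) oe_filter set" where
  "K_ctrb I = {K \<in> K_stab. posdef (Sigma22 I K)}"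

definition P_star :: "('n::finite, 'm::finite, 'p::finite) oe_instance \<Rightarrow> real^'n^'n" where
  "P_star I = (THE P. possemidef P
     \<and> sysA I ** P + P ** transpose (sysA I)
         - P ** transpose (sysC I) ** matrix_inv (covW2 I) ** sysC I ** P + covW1 I = 0
     \<and> hurwitz (sysA I - P ** transpose (sysC I) ** matrix_inv (covW2 I) ** sysC I))"

definition L_star :: "('n::finite, 'm::finite, 'p::finite) oe_instance \<Rightarrow> real^'m^'n" where
  "L_star I = P_star I ** transpose (sysC I) ** matrix_inv (covW2 I)"

definition K_opt :: "('n::finite, 'm::finite, 'p::finite) oe_instance
    \<Rightarrow> ('n, 'm, 'p) oe_filter set" where
  "K_opt I = {(S ** (sysA I - L_star I ** sysC I) ** matrix_inv S,
               S ** L_star I,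
               sysG I ** matrix_inv S) | S. invertible S}"

definition S1 :: "('n::finite, 'm::finite, 'p::finite) oe_instance \<Rightarrow> bool" where
  "S1 I \<longleftrightarrow> hurwitz (sysA I)"

definition S2 :: "('n::finite, 'm::finite, 'p::finite) oe_instance \<Rightarrow> bool" where
  "S2 I \<longleftrightarrow> observable (sysA I) (sysC I)"

definition S3 :: "('n::finite, 'm::finite, 'p::finite) oe_instance \<Rightarrow> bool" where
  "S3 I \<longleftrightarrow> posdef (covW1 I) \<and> posdef (covW2 I)"

definition S4 :: "('n::finite, 'm::finite, 'p::finite) oe_instance \<Rightarrow> bool" where
  "S4 I \<longleftrightarrow> (\<forall>(AK, BK, CK) \<in> K_opt I. controllable AK BK)"

text \<open>
  White Gaussian noise of intensity \<open>W\<close> is the formal time derivative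
  of a Brownian motion \<open>b\<close> with covariance \<open>W\<close> per unit time.  As the noise is additive, an
  equation \<open>d\<xi>/dt = F \<xi> + db/dt\<close> with \<open>\<xi>(0) = 0\<close> is the pathwise integral
  equation \<open>\<xi>(t) = (integral of F \<xi> over [0, t]) + b(t)\<close>; no stochastic integral is needed.
\<close>

definition centered_gaussian :: "'w measure \<Rightarrow> ('w \<Rightarrow> real) \<Rightarrow> real \<Rightarrow> bool" where
  "centered_gaussian M X var \<longleftrightarrow> X \<in> borel_measurable M \<and>
     distr M borel X =
       (if var = 0 then return borel 0 else density lborel (normal_density 0 (sqrt var)))"

(* A random vector is N(0, V) iff each u \<bullet> X is N(0, u \<bullet> V u). *)
definition brownian_motion ::
  "'w measure \<Rightarrow> real^'n^'n \<Rightarrow> (real \<Rightarrow> 'w \<Rightarrow> real^'n) \<Rightarrow> bool" where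
  "brownian_motion M W b \<longleftrightarrow>
     (\<forall>t\<ge>0. b t \<in> borel_measurable M) \<and>
     (\<forall>\<omega>\<in>space M. b 0 \<omega> = 0 \<and> continuous_on {0..} (\<lambda>t. b t \<omega>)) \<and>
     (\<forall>s t u. 0 \<le> s \<and> s \<le> t \<longrightarrow>
        centered_gaussian M (\<lambda>\<omega>. u \<bullet> (b t \<omega> - b s \<omega>)) ((t - s) * (u \<bullet> (W *v u)))) \<and>
     (\<forall>\<tau> :: nat \<Rightarrow> real. 0 \<le> \<tau> 0 \<and> incseq \<tau> \<longrightarrow>
        prob_space.indep_vars M (\<lambda>_. borel) (\<lambda>i \<omega>. b (\<tau> (Suc i)) \<omega> - b (\<tau> i) \<omega>) UNIV)"

(* The sigma-algebra generated by the values b t for t \<ge> 0. *)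
definition process_events :: "'w measure \<Rightarrow> (real \<Rightarrow> 'w \<Rightarrow> real^'n) \<Rightarrow> 'w set set" where
  "process_events M b =
     sigma_sets (space M) (\<Union>t\<in>{0..}. {b t -` B \<inter> space M | B. B \<in> sets borel})"

(* w and v are the integrated process and measurement noises. *)
definition oe_noise :: "('n::finite, 'm::finite, 'p::finite) oe_instance \<Rightarrow> 'w measure
    \<Rightarrow> (real \<Rightarrow> 'w \<Rightarrow> real^'n) \<Rightarrow> (real \<Rightarrow> 'w \<Rightarrow> real^'m) \<Rightarrow> bool" where
  "oe_noise I M w v \<longleftrightarrow> prob_space M \<and>
     brownian_motion M (covW1 I) w \<and> brownian_motion M (covW2 I) v \<and>
     prob_space.indep_set M (process_events M w) (process_events M v)"

(* Pinning the values at negative times makes the solution unique as a function on the reals. *)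
definition linear_response :: "real^'n^'n \<Rightarrow> (real \<Rightarrow> real^'n) \<Rightarrow> real \<Rightarrow> real^'n" where
  "linear_response F b = (THE \<xi>. continuous_on {0..} \<xi> \<and>
     (\<forall>t<0. \<xi> t = 0) \<and>
     (\<forall>t\<ge>0. \<xi> t = integral {0..t} (\<lambda>s. F *v \<xi> s) + b t))"

definition oe_state :: "('n::finite, 'm::finite, 'p::finite) oe_instance
    \<Rightarrow> (real \<Rightarrow> 'w \<Rightarrow> real^'n) \<Rightarrow> real \<Rightarrow> 'w \<Rightarrow> real^'n" where
  "oe_state I w t \<omega> = linear_response (sysA I) (\<lambda>s. w s \<omega>) t"

(* The integral of y = C x + dv/dt over [0, t]. *)
definition integrated_output :: "('n::finite, 'm::finite, 'p::finite) oe_instance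
    \<Rightarrow> (real \<Rightarrow> 'w \<Rightarrow> real^'n) \<Rightarrow> (real \<Rightarrow> 'w \<Rightarrow> real^'m) \<Rightarrow> real \<Rightarrow> 'w \<Rightarrow> real^'m" where
  "integrated_output I w v t \<omega> = integral {0..t} (\<lambda>s. sysC I *v oe_state I w s \<omega>) + v t \<omega>"

(* The filter is initialised at 0; for stable filters the loss does not depend on this choice. *)
definition filter_state :: "('n::finite, 'm::finite, 'p::finite) oe_instance
    \<Rightarrow> (real \<Rightarrow> 'w \<Rightarrow> real^'n) \<Rightarrow> (real \<Rightarrow> 'w \<Rightarrow> real^'m)
    \<Rightarrow> ('n, 'm, 'p) oe_filter \<Rightarrow> real \<Rightarrow> 'w \<Rightarrow> real^'n" where
  "filter_state I w v = (\<lambda>(AK, BK, CK) t \<omega>.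
     linear_response AK (\<lambda>s. BK *v integrated_output I w v s \<omega>) t)"

definition oe_loss :: "('n::finite, 'm::finite, 'p::finite) oe_instance \<Rightarrow> 'w measure
    \<Rightarrow> (real \<Rightarrow> 'w \<Rightarrow> real^'n) \<Rightarrow> (real \<Rightarrow> 'w \<Rightarrow> real^'m)
    \<Rightarrow> ('n, 'm, 'p) oe_filter \<Rightarrow> real" where
  "oe_loss I M w v K = Lim at_top (\<lambda>t. prob_space.expectation M
     (\<lambda>\<omega>. (norm (sysG I *v oe_state I w t \<omega> - snd (snd K) *v filter_state I w v K t \<omega>))\<^sup>2))"

definition level_set :: "('n::finite, 'm::finite, 'p::finite) oe_instance \<Rightarrow> 'w measure
    \<Rightarrow> (real \<Rightarrow> 'w \<Rightarrow> real^'n) \<Rightarrow> (real \<Rightarrow> 'w \<Rightarrow> real^'m)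
    \<Rightarrow> real \<Rightarrow> ('n, 'm, 'p) oe_filter set" where
  "level_set I M w v c = {K \<in> K_stab. oe_loss I M w v K \<le> c}"

definition I_bad :: "(2, 2, 2) oe_instance" where
  "I_bad = \<lparr>sysA = - mat 1, sysC = mat 1, sysG = mat 1,
            covW1 = 3 *\<^sub>R mat 1, covW2 = mat 1\<rparr>"

definition K_bad :: "real \<Rightarrow> (2, 2, 2) oe_filter" where
  "K_bad \<gamma> = (vector [vector [- 2, 0], vector [\<gamma>, - \<gamma>]],
              vector [vector [1, 0], vector [0, 0]],
              vector [vector [1, 0], vector [0, 0]])"

end

theory Submission
  imports Defs
begin

text \<open>
  Writing \<open>\<Phi>(t)\<close> for the fundamental matrix of the closed loop \<open>F\<close>, the state is
  \<open>\<xi>(t) = b(t) + \<Phi>(t) \<integral> \<Phi>(- s) F b(s) ds\<close> along every noise path \<open>b\<close>, so that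
  \<open>c \<bullet> \<xi>(t) = h(t) \<bullet> b(t) - \<integral> h'(s) \<bullet> b(s) ds\<close> with \<open>h(s) = (\<Phi>(t) \<Phi>(- s))\<^sup>T c\<close>.
  Since the noise has covariance kernel \<open>min s r W\<close>, Fubini and integration by parts give
  \<open>E (c \<bullet> \<xi>(t))\<^sup>2 = \<integral> h \<bullet> W h\<close>.  If \<open>F \<Sigma> + \<Sigma> F\<^sup>T + W = 0\<close>, this integrand is the derivative of
  \<open>h \<bullet> \<Sigma> h\<close>, and a quadratic Lyapunov form for \<open>F\<close> makes \<open>h(0)\<close> vanish as \<open>t \<rightarrow> \<infinity>\<close>; hence the loss
  is the trace expression in \<open>\<Sigma>\<close>.  The same Lyapunov form serves all filters near the
  critical one and makes \<open>\<Sigma>\<close> continuous there.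

  For the gradient, contract the Lyapunov equation with the dual solution
  \<open>Q = (x\<^sub>1 - z\<^sub>1)\<^sup>2 / 4 + x\<^sub>2\<^sup>2 / 2\<close> at the critical filter, where \<open>z\<close> is the filter state: the loss
  minus \<open>5 / 2\<close> becomes the inner product of the filter increment with a slope that is
  continuous in \<open>\<Sigma>\<close> and vanishes at the critical filter.
\<close>

section \<open>Fundamental matrices and linear responses\<close>

text \<open>\<open>K_bad \<gamma>\<close> is the optimal scalar filter for the first coordinate x1
  and discards the second measurement. Its second state z2 is a lag with rate \<gamma> behind z1
  that the output never reads: it leaves the loss untouched and makes \<open>Sigma22\<close>
  positive definite, while x2 stays uncorrelated with the whole filter. The loss is 1 + 3 / 2, the
  optimal error variance of x1 plus the variance of x2. Extracting information on x2 takes a nonzero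
  B entry and a nonzero C entry at once, a second-order effect; hence criticality without
  optimality. Q arises because the noise-free error x1 - z1 decays at rate 2 and x2 at rate 1, so
  that minus the drift of Q is the squared output error. The obstacle is that the gradient concerns
  a limit of expectations, which has to be identified on a whole neighbourhood of filters. Instead
  of perturbing eigenvalues, the proof carries a strict quadratic inequality with fixed
  \<open>D\<close>, visibly an open condition. An increment formula with a continuous slope then
  reduces differentiability of the loss to continuity of the covariance.\<close>

lemma bounded_bilinear_matrix_matrix_mult:
  "bounded_bilinear ((**) :: real^'n::finite^'m::finite \<Rightarrow> real^'p::finite^'n \<Rightarrow> real^'p^'m)"
proof -
  have "bilinear ((**) :: real^'n::finite^'m::finite \<Rightarrow> real^'p::finite^'n \<Rightarrow> real^'p^'m)"
    unfolding bilinear_def linear_iff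
    by (auto simp: vec_eq_iff matrix_matrix_mult_def algebra_simps sum.distrib sum_distrib_left)
  then show ?thesis by (simp add: bilinear_conv_bounded_bilinear)
qed

lemma bounded_bilinear_matrix_vector_mult:
  "bounded_bilinear ((*v) :: real^'n::finite^'m::finite \<Rightarrow> real^'n \<Rightarrow> real^'m)"
proof -
  have "bilinear ((*v) :: real^'n::finite^'m::finite \<Rightarrow> real^'n \<Rightarrow> real^'m)"
    unfolding bilinear_def linear_iff
    by (auto simp: vec_eq_iff matrix_vector_mult_def algebra_simps sum.distrib sum_distrib_left)
  then show ?thesis by (simp add: bilinear_conv_bounded_bilinear)
qed

lemma bounded_linear_transpose: "bounded_linear (transpose :: real^'n^'m \<Rightarrow> real^'m^'n)"
  by (intro linear_conv_bounded_linear[THEN iffD1] linearI) (simp_all add: transpose_def vec_eq_iff)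

lemmas transpose_zero = linear_0[OF bounded_linear.linear[OF bounded_linear_transpose]]
lemmas transpose_diff = linear_diff[OF bounded_linear.linear[OF bounded_linear_transpose]]

lemmas continuous_on_matrix_matrix_mult [continuous_intros] =
  bounded_bilinear.continuous_on[OF bounded_bilinear_matrix_matrix_mult]
lemmas continuous_on_matrix_vector_mult [continuous_intros] =
  bounded_bilinear.continuous_on[OF bounded_bilinear_matrix_vector_mult]
lemmas continuous_on_transpose [continuous_intros] =
  bounded_linear.continuous_on[OF bounded_linear_transpose]
lemmas has_vector_derivative_matrix_matrix_mult =
  bounded_bilinear.has_vector_derivative[OF bounded_bilinear_matrix_matrix_mult]
lemmas has_vector_derivative_matrix_vector_mult =
  bounded_bilinear.has_vector_derivative[OF bounded_bilinear_matrix_vector_mult]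

lemma has_vector_derivative_componentwise:
  fixes f :: "real \<Rightarrow> 'b::euclidean_space^'n"
  assumes "\<And>i. ((\<lambda>t. f t $ i) has_vector_derivative d $ i) (at t within T)"
  shows "(f has_vector_derivative d) (at t within T)"
  unfolding has_vector_derivative_def
proof (subst has_derivative_componentwise_within, rule ballI)
  fix x :: "'b^'n" assume "x \<in> Basis"
  then obtain i u where x: "x = axis i u" by (auto simp: Basis_vec_def)
  have "((\<lambda>t. f t $ i \<bullet> u) has_derivative (\<lambda>h. (h *\<^sub>R d $ i) \<bullet> u)) (at t within T)"
    using assms[of i] unfolding has_vector_derivative_def by (rule has_derivative_inner_left)
  then show "((\<lambda>t. f t \<bullet> x) has_derivative (\<lambda>h. (h *\<^sub>R d) \<bullet> x)) (at t within T)"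
    by (simp add: x inner_axis)
qed

lemma norm_matrix_power_le:
  fixes F :: "real^'n::finite^'n"
  shows "\<exists>C>0. \<forall>k. norm (((**) F ^^ k) (mat 1)) \<le> C ^ k * norm (mat 1 :: real^'n^'n)"
proof -
  obtain K where K: "K > 0" "\<And>X Y. norm (X ** Y :: real^'n^'n) \<le> norm (X :: real^'n^'n) * norm (Y :: real^'n^'n) * K"
    using bounded_bilinear.pos_bounded[OF bounded_bilinear_matrix_matrix_mult] by blast
  \<comment> \<open>K is the constant of the bounded bilinear product; the summand 1 keeps C
    positive when F = 0.\<close>
  define C where "C = norm F * K + 1"
  have C: "C > 0" using K(1) by (simp add: C_def add_nonneg_pos)
  have "norm (((**) F ^^ k) (mat 1)) \<le> C ^ k * norm (mat 1 :: real^'n^'n)" for k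
  proof (induction k)
    case (Suc k)
    have "norm (((**) F ^^ Suc k) (mat 1)) \<le> norm F * K * norm (((**) F ^^ k) (mat 1))"
      using K(2)[of F "((**) F ^^ k) (mat 1)"] by (simp add: mult_ac)
    also have "\<dots> \<le> C * (C ^ k * norm (mat 1 :: real^'n^'n))"
      using K(1) C by (intro mult_mono Suc.IH) (auto simp: C_def)
    finally show ?case by (simp add: mult_ac)
  qed simp
  with C show ?thesis by blast
qed

text \<open>The function meant is t -> exp(t F). Commutation is included because the derivatives of
  \<Phi>(-t) and of the transpose need F on the other side.\<close>

definition fundamental_matrix :: "real^'n^'n \<Rightarrow> (real \<Rightarrow> real^'n^'n) \<Rightarrow> bool" where
  "fundamental_matrix F \<Phi> \<longleftrightarrow> \<Phi> 0 = mat 1 \<and>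
     (\<forall>t. (\<Phi> has_vector_derivative F ** \<Phi> t) (at t)) \<and> (\<forall>t. F ** \<Phi> t = \<Phi> t ** F)"

lemma matrix_power_commute: "F ** ((**) F ^^ k) (mat 1) = ((**) F ^^ k) (mat 1) ** (F :: real^'n^'n)"
proof (induction k)
  case (Suc k)
  then show ?case by simp (metis matrix_mul_assoc)
qed simp

text \<open>Entry by entry the exponential series is a scalar power series, so termwise
  differentiation applies; commutation is inherited from the powers of F.\<close>

lemma fundamental_matrix_exists:
  fixes F :: "real^'n::finite^'n"
  shows "\<exists>\<Phi>. fundamental_matrix F \<Phi>"
proof -
  define P where "P k = ((**) F ^^ k) (mat 1)" for k
  define c where "c i j k = P k $ i $ j / fact k" for i j k
  define \<Phi> where "\<Phi> t = (\<chi> i j. \<Sum>k. c i j k * t ^ k)" for t :: real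
  obtain C where C: "C > 0" "\<And>k. norm (P k) \<le> C ^ k * norm (mat 1 :: real^'n^'n)"
    using norm_matrix_power_le[of F] by (auto simp: P_def)
  have summ: "summable (\<lambda>k. c i j k * t ^ k)" for i j t
  proof (rule summable_comparison_test)
    show "summable (\<lambda>k. norm (mat 1 :: real^'n^'n) * (inverse (fact k) * (C * \<bar>t\<bar>) ^ k))"
      by (intro summable_mult summable_exp)
    have "norm (c i j k * t ^ k) \<le> norm (mat 1 :: real^'n^'n) * (inverse (fact k) * (C * \<bar>t\<bar>) ^ k)" for k
    proof -
      have "\<bar>P k $ i $ j\<bar> \<le> norm (P k $ i)" by (rule component_le_norm_cart)
      also have "\<dots> \<le> norm (P k)" by (rule Finite_Cartesian_Product.norm_nth_le)
      also have "\<dots> \<le> C ^ k * norm (mat 1 :: real^'n^'n)" by (rule C)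
      finally have "\<bar>P k $ i $ j\<bar> * (\<bar>t\<bar> ^ k * inverse (fact k))
          \<le> C ^ k * norm (mat 1 :: real^'n^'n) * (\<bar>t\<bar> ^ k * inverse (fact k))"
        by (rule mult_right_mono) simp
      then show ?thesis
        by (simp add: c_def abs_mult power_abs power_mult_distrib field_simps)
    qed
    then show "\<exists>N. \<forall>k\<ge>N. norm (c i j k * t ^ k)
        \<le> norm (mat 1 :: real^'n^'n) * (inverse (fact k) * (C * \<bar>t\<bar>) ^ k)" by blast
  qed
  have left: "(F ** \<Phi> t) $ i $ j = (\<Sum>k. (F ** P k) $ i $ j / fact k * t ^ k)" for t i j
  proof -
    have "(F ** \<Phi> t) $ i $ j = (\<Sum>l\<in>UNIV. \<Sum>k. F $ i $ l * (c l j k * t ^ k))"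
      by (simp add: matrix_matrix_mult_def \<Phi>_def suminf_mult[OF summ])
    also have "\<dots> = (\<Sum>k. \<Sum>l\<in>UNIV. F $ i $ l * (c l j k * t ^ k))"
      by (rule suminf_sum[symmetric]) (intro summable_mult summ)
    also have "\<dots> = (\<Sum>k. (F ** P k) $ i $ j / fact k * t ^ k)"
      by (simp add: matrix_matrix_mult_def c_def sum_distrib_left sum_distrib_right sum_divide_distrib mult_ac)
    finally show ?thesis .
  qed
  have right: "(\<Phi> t ** F) $ i $ j = (\<Sum>k. (P k ** F) $ i $ j / fact k * t ^ k)" for t i j
  proof -
    have "(\<Phi> t ** F) $ i $ j = (\<Sum>l\<in>UNIV. \<Sum>k. (c i l k * t ^ k) * F $ l $ j)"
      by (simp add: matrix_matrix_mult_def \<Phi>_def suminf_mult2[OF summ])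
    also have "\<dots> = (\<Sum>k. \<Sum>l\<in>UNIV. (c i l k * t ^ k) * F $ l $ j)"
      by (rule suminf_sum[symmetric]) (intro summable_mult2 summ)
    also have "\<dots> = (\<Sum>k. (P k ** F) $ i $ j / fact k * t ^ k)"
      by (simp add: matrix_matrix_mult_def c_def sum_distrib_left sum_distrib_right sum_divide_distrib mult_ac)
    finally show ?thesis .
  qed
  have "(\<Phi> has_vector_derivative F ** \<Phi> t) (at t)" for t
  proof (intro has_vector_derivative_componentwise)
    fix i j
    have "((\<lambda>t. \<Sum>k. c i j k * t ^ k) has_field_derivative (\<Sum>k. diffs (c i j) k * t ^ k)) (at t)"
      by (rule termdiffs_strong_converges_everywhere) (rule summ)
    moreover have "diffs (c i j) k = (F ** P k) $ i $ j / fact k" for k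
      by (simp add: diffs_def c_def P_def del: of_nat_Suc)
    ultimately have "((\<lambda>t. \<Sum>k. c i j k * t ^ k) has_vector_derivative (F ** \<Phi> t) $ i $ j) (at t)"
      by (simp only: left has_real_derivative_iff_has_vector_derivative)
    then show "((\<lambda>t. \<Phi> t $ i $ j) has_vector_derivative (F ** \<Phi> t) $ i $ j) (at t)"
      by (simp add: \<Phi>_def)
  qed
  moreover have "F ** \<Phi> t = \<Phi> t ** F" for t
    by (simp add: vec_eq_iff left right P_def matrix_power_commute)
  moreover have "\<Phi> 0 = mat 1"
    by (simp add: \<Phi>_def vec_eq_iff powser_zero) (simp add: c_def P_def)
  ultimately show ?thesis by (auto simp: fundamental_matrix_def)
qed

context
  fixes F :: "real^'n::finite^'n" and \<Phi> :: "real \<Rightarrow> real^'n^'n"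
  assumes \<Phi>: "fundamental_matrix F \<Phi>"
begin

lemma fundamental_matrix_0: "\<Phi> 0 = mat 1"
  and fundamental_matrix_commute: "F ** \<Phi> t = \<Phi> t ** F"
  and fundamental_matrix_derivative: "(\<Phi> has_vector_derivative F ** \<Phi> t) (at t within T)"
  using \<Phi> by (auto simp: fundamental_matrix_def intro: has_vector_derivative_at_within)

lemma fundamental_matrix_derivative_neg:
  "((\<lambda>t. \<Phi> (- t)) has_vector_derivative - (\<Phi> (- t) ** F)) (at t within T)"
proof -
  have "((\<Phi> \<circ> uminus) has_vector_derivative (-1) *\<^sub>R (F ** \<Phi> (- t))) (at t)"
    by (rule vector_diff_chain_at) (auto intro!: derivative_eq_intros fundamental_matrix_derivative)
  then show ?thesis
    by (auto simp: o_def fundamental_matrix_commute intro: has_vector_derivative_at_within)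
qed

lemma fundamental_matrix_neg_continuous: "continuous_on T (\<lambda>t. \<Phi> (- t))"
  by (rule continuous_on_vector_derivative) (rule fundamental_matrix_derivative_neg)

lemma fundamental_matrix_transpose_derivative:
  "((\<lambda>t. transpose (\<Phi> t) *v c) has_vector_derivative transpose F *v (transpose (\<Phi> t) *v c)) (at t)"
proof -
  have "((\<lambda>t. transpose (\<Phi> t)) has_vector_derivative transpose (\<Phi> t ** F)) (at t)"
    using bounded_linear.has_vector_derivative[OF bounded_linear_transpose
        fundamental_matrix_derivative]
    by (simp add: fundamental_matrix_commute)
  from has_vector_derivative_matrix_vector_mult[OF this has_vector_derivative_const[of c]]
  show ?thesis
    by (simp add: matrix_transpose_mul matrix_vector_mul_assoc del: transpose_matrix_vector)
qed

lemma fundamental_matrix_inverse: "\<Phi> t ** \<Phi> (- t) = mat 1"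
proof -
  have "((\<lambda>t. \<Phi> (- t) ** \<Phi> t) has_vector_derivative 0) (at t within UNIV)" for t
    using has_vector_derivative_matrix_matrix_mult[OF fundamental_matrix_derivative_neg[of t]
        fundamental_matrix_derivative]
    by (simp add: matrix_mul_assoc bounded_bilinear.minus_left[OF bounded_bilinear_matrix_matrix_mult])
  then obtain X where "\<Phi> (- t) ** \<Phi> t = X" for t
    using has_vector_derivative_zero_constant[of UNIV "\<lambda>t. \<Phi> (- t) ** \<Phi> t"] by auto
  from this[of t] this[of 0] have "\<Phi> (- t) ** \<Phi> t = mat 1"
    by (simp add: fundamental_matrix_0)
  then show ?thesis
    by (simp add: matrix_left_right_inverse)
qed

text \<open>Noise paths are merely continuous, so variation of constants is applied to \<eta> =
  \<xi> - b, which satisfies \<eta>' = F \<eta> + F b. The integrating factor \<Phi>(-s) leaves only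
  the forcing term.\<close>

lemma linear_response_unique:
  fixes b \<xi> :: "real \<Rightarrow> real^'n"
  assumes b: "continuous_on {0..} b" and \<xi>: "continuous_on {0..} \<xi>"
    and eq: "\<And>t. t \<ge> 0 \<Longrightarrow> \<xi> t = integral {0..t} (\<lambda>s. F *v \<xi> s) + b t"
    and t: "t \<ge> 0"
  shows "\<xi> t = b t + \<Phi> t *v integral {0..t} (\<lambda>s. \<Phi> (- s) *v (F *v b s))"
proof -
  define \<eta> where "\<eta> s = integral {0..s} (\<lambda>s. F *v \<xi> s)" for s
  have cF: "continuous_on {0..t} (\<lambda>s. F *v \<xi> s)"
    by (intro continuous_intros continuous_on_subset[OF \<xi>]) auto
  have d: "((\<lambda>s. \<Phi> (- s) *v \<eta> s) has_vector_derivative \<Phi> (- s) *v (F *v b s)) (at s within {0..t})"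
    if s: "s \<in> {0..t}" for s
  proof -
    have d\<eta>: "(\<eta> has_vector_derivative F *v \<xi> s) (at s within {0..t})"
      unfolding \<eta>_def by (rule integral_has_vector_derivative[OF cF s])
    have x: "\<xi> s = \<eta> s + b s" using eq[of s] s by (simp add: \<eta>_def)
    show ?thesis
      by (rule has_vector_derivative_eq_rhs[OF has_vector_derivative_matrix_vector_mult
            [OF fundamental_matrix_derivative_neg d\<eta>]])
        (simp add: x matrix_vector_right_distrib matrix_vector_mul_assoc
          bounded_bilinear.minus_left[OF bounded_bilinear_matrix_vector_mult])
  qed
  have "((\<lambda>s. \<Phi> (- s) *v (F *v b s)) has_integral \<Phi> (- t) *v \<eta> t - \<Phi> (- 0) *v \<eta> 0) {0..t}"
    by (rule fundamental_theorem_of_calculus[OF t d])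
  then have "integral {0..t} (\<lambda>s. \<Phi> (- s) *v (F *v b s)) = \<Phi> (- t) *v \<eta> t"
    by (simp add: integral_unique \<eta>_def)
  then have "\<Phi> t *v integral {0..t} (\<lambda>s. \<Phi> (- s) *v (F *v b s)) = \<eta> t"
    by (simp add: matrix_vector_mul_assoc fundamental_matrix_inverse)
  then show ?thesis using eq[OF t] by (simp add: \<eta>_def)
qed

lemma linear_response_exists:
  fixes b :: "real \<Rightarrow> real^'n"
  assumes b: "continuous_on {0..} b"
  defines "\<eta> \<equiv> \<lambda>t. \<Phi> t *v integral {0..t} (\<lambda>s. \<Phi> (- s) *v (F *v b s))"
  shows "continuous_on {0..} \<eta>"
    and "\<And>t. t \<ge> 0 \<Longrightarrow> integral {0..t} (\<lambda>s. F *v (b s + \<eta> s)) = \<eta> t"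
proof -
  have d: "(\<eta> has_vector_derivative F *v (b s + \<eta> s)) (at s within {0..t})"
    if s: "s \<in> {0..t}" for s t
  proof -
    have "continuous_on {0..t} (\<lambda>s. \<Phi> (- s) *v (F *v b s))"
      by (intro continuous_intros fundamental_matrix_neg_continuous continuous_on_subset[OF b]) auto
    note has_vector_derivative_matrix_vector_mult[OF fundamental_matrix_derivative
        integral_has_vector_derivative[OF this s]]
    moreover have "\<Phi> s *v (\<Phi> (- s) *v (F *v b s)) = F *v b s"
      by (simp add: matrix_vector_mul_assoc matrix_mul_assoc fundamental_matrix_inverse)
    ultimately show ?thesis
      by (simp add: \<eta>_def matrix_vector_right_distrib flip: matrix_vector_mul_assoc)
  qed
  have "continuous (at t within {0..}) \<eta>" if "t \<ge> 0" for t
  proof -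
    \<comment> \<open>The derivative is known within compact intervals only; near t the half-line
      agrees with this one, also at t = 0.\<close>
    have "at t within {0..} = at t within {0..t + 1}"
      by (rule at_within_nhd[of t "{..<t + 1}"]) auto
    moreover have "continuous (at t within {0..t + 1}) \<eta>"
      using d[of t "t + 1"] that by (auto intro: has_vector_derivative_continuous)
    ultimately show ?thesis by simp
  qed
  then show "continuous_on {0..} \<eta>"
    by (simp add: continuous_on_eq_continuous_within)
  show "integral {0..t} (\<lambda>s. F *v (b s + \<eta> s)) = \<eta> t" if "t \<ge> 0" for t
    using fundamental_theorem_of_calculus[OF that d] by (simp add: \<eta>_def integral_unique)
qed
end

section \<open>Lyapunov forms\<close>

lemma inner_matrix_vector_mult_transpose:
  "x \<bullet> (A *v y) = (transpose A *v x) \<bullet> y" for A :: "real^'n::finite^'m::finite"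
  by (simp add: dot_lmul_matrix)

text \<open>The second condition concerns \<open>p' = F\<^sup>T p\<close>, because it is the dual flow \<open>\<Phi>(t)\<^sup>T c\<close> that enters the second moments.\<close>

definition lyapunov_form :: "real^'n^'n \<Rightarrow> real^'n^'n \<Rightarrow> bool" where
  "lyapunov_form D F \<longleftrightarrow> transpose D = D \<and> (\<exists>\<nu>>0. \<forall>p. \<nu> * (p \<bullet> p) \<le> p \<bullet> (D *v p)) \<and>
     (\<exists>\<kappa>>0. \<forall>p. p \<bullet> ((D ** transpose F) *v p) \<le> - \<kappa> * (p \<bullet> p))"

text \<open>Along p' = F^T p the form V = p . D p decays exponentially, and positivity of
  \<open>D\<close> transfers the decay to p.\<close>

lemma lyapunov_form_decay:
  fixes F :: "real^'n::finite^'n"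
  assumes \<Phi>: "fundamental_matrix F \<Phi>" and D: "lyapunov_form D F"
  shows "((\<lambda>t. transpose (\<Phi> t) *v c) \<longlongrightarrow> 0) at_top"
proof -
  obtain \<nu> \<kappa> where sym: "transpose D = D" and \<nu>: "\<nu> > 0" "\<And>p. \<nu> * (p \<bullet> p) \<le> p \<bullet> (D *v p)"
    and \<kappa>: "\<kappa> > 0" "\<And>p. p \<bullet> ((D ** transpose F) *v p) \<le> - \<kappa> * (p \<bullet> p)"
    using D unfolding lyapunov_form_def by blast
  obtain K where K: "K > 0" "\<And>p. norm (D *v p) \<le> norm p * K"
    using bounded_linear.pos_bounded[OF matrix_vector_mul_bounded_linear[of D]] by blast
  define p where "p t = transpose (\<Phi> t) *v c" for t
  define V where "V t = p t \<bullet> (D *v p t)" for t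
  \<comment> \<open>Since V <= K |p|^2, the dissipation 2 \<kappa> |p|^2 is at least \<mu>
    V.\<close>
  define \<mu> where "\<mu> = 2 * \<kappa> / K"
  have \<mu>: "\<mu> > 0" using \<kappa>(1) K(1) by (simp add: \<mu>_def)
  have dp: "(p has_vector_derivative transpose F *v p t) (at t)" for t
    unfolding p_def by (rule fundamental_matrix_transpose_derivative[OF \<Phi>])
  have dV: "(V has_real_derivative 2 * (p t \<bullet> ((D ** transpose F) *v p t))) (at t)" for t
  proof -
    have "((\<lambda>t. D *v p t) has_vector_derivative D *v (transpose F *v p t)) (at t)"
      by (rule bounded_linear.has_vector_derivative[OF matrix_vector_mul_bounded_linear dp])
    from bounded_bilinear.has_vector_derivative[OF bounded_bilinear_inner dp this]
    have "(V has_vector_derivative p t \<bullet> (D *v (transpose F *v p t)) + (transpose F *v p t) \<bullet> (D *v p t)) (at t)"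
      unfolding V_def .
    moreover have "(transpose F *v p t) \<bullet> (D *v p t) = p t \<bullet> (D *v (transpose F *v p t))"
      using inner_matrix_vector_mult_transpose[of "transpose F *v p t" D "p t"]
      by (simp add: sym inner_commute)
    ultimately show ?thesis
      by (simp add: has_real_derivative_iff_has_vector_derivative matrix_vector_mul_assoc
          del: transpose_matrix_vector)
  qed
  have decr: "V t * exp (\<mu> * t) \<le> V 0 * exp (\<mu> * 0)" if "t \<ge> 0" for t
  proof (rule DERIV_nonpos_imp_nonincreasing[OF that])
    fix s :: real
    have "V s \<le> norm (p s) * norm (D *v p s)"
      unfolding V_def by (rule norm_cauchy_schwarz)
    also have "\<dots> \<le> norm (p s) * (norm (p s) * K)"
      by (intro mult_left_mono K) auto
    finally have "\<mu> * V s \<le> \<mu> * (K * (p s \<bullet> p s))"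
      using \<mu> by (intro mult_left_mono) (simp_all add: dot_square_norm power2_eq_square mult_ac)
    also have "\<dots> = 2 * \<kappa> * (p s \<bullet> p s)"
      using K(1) by (simp add: \<mu>_def)
    finally have nonpos: "2 * (p s \<bullet> ((D ** transpose F) *v p s)) + \<mu> * V s \<le> 0"
      using \<kappa>(2)[of "p s"] by linarith
    have "((\<lambda>t. exp (\<mu> * t)) has_real_derivative exp (\<mu> * s) * \<mu>) (at s)"
      by (auto intro!: derivative_eq_intros)
    from DERIV_mult[OF dV this] have "((\<lambda>t. V t * exp (\<mu> * t)) has_real_derivative
        (2 * (p s \<bullet> ((D ** transpose F) *v p s)) + \<mu> * V s) * exp (\<mu> * s)) (at s)"
      by (rule DERIV_cong) (simp only: distrib_left distrib_right mult_ac)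
    with mult_nonpos_nonneg[OF nonpos exp_ge_zero]
    show "\<exists>y. ((\<lambda>t. V t * exp (\<mu> * t)) has_real_derivative y) (at s) \<and> y \<le> 0"
      by blast
  qed
  have *: "(norm (p t))\<^sup>2 \<le> V 0 / \<nu> * exp (- (\<mu> * t))" if "t \<ge> 0" for t
  proof -
    have "\<nu> * (norm (p t))\<^sup>2 \<le> V t"
      using \<nu>(2)[of "p t"] by (simp add: V_def dot_square_norm)
    also have "V t = V t * exp (\<mu> * t) * exp (- (\<mu> * t))"
      by (simp add: exp_minus)
    also have "\<dots> \<le> V 0 * exp (\<mu> * 0) * exp (- (\<mu> * t))"
      by (intro mult_right_mono decr that) simp
    finally show ?thesis
      using \<nu>(1) by (simp add: pos_le_divide_eq mult.commute)
  qed
  have "\<forall>\<^sub>F t in at_top. (norm (p t))\<^sup>2 \<le> V 0 / \<nu> * exp (- (\<mu> * t))"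
    using * by (rule eventually_mono[OF eventually_ge_at_top])
  moreover have "((\<lambda>t. V 0 / \<nu> * exp (- (\<mu> * t))) \<longlongrightarrow> 0) at_top"
  proof -
    have "filterlim (\<lambda>t. \<mu> * t) at_top at_top"
      by (rule filterlim_tendsto_pos_mult_at_top[OF tendsto_const \<mu> filterlim_ident])
    then have "filterlim (\<lambda>t. - (\<mu> * t)) at_bot at_top"
      by (simp add: filterlim_uminus_at_bot)
    from filterlim_compose[OF exp_at_bot this] have "((\<lambda>t. exp (- (\<mu> * t))) \<longlongrightarrow> 0) at_top" .
    from tendsto_mult_left[OF this, of "V 0 / \<nu>"] show ?thesis by simp
  qed
  ultimately have "((\<lambda>t. (norm (p t))\<^sup>2) \<longlongrightarrow> 0) at_top"
    by (rule tendsto_sandwich[OF always_eventually _ tendsto_const, rotated]) simp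
  then have "((\<lambda>t. sqrt ((norm (p t))\<^sup>2)) \<longlongrightarrow> sqrt 0) at_top"
    by (rule tendsto_real_sqrt)
  then show ?thesis
    unfolding p_def by (simp add: tendsto_norm_zero_iff)
qed

text \<open>Only the dissipation inequality involves the matrix, and it is strict: for a small
  perturbation the same \<open>D\<close> works with \<kappa> / 2 in place of \<kappa>.\<close>

lemma eventually_lyapunov_form:
  fixes F :: "real^'n::finite^'n"
  assumes D: "lyapunov_form D F"
  shows "\<forall>\<^sub>F G in nhds F. lyapunov_form D G"
proof -
  obtain \<kappa> where \<kappa>: "\<kappa> > 0" "\<And>p. p \<bullet> ((D ** transpose F) *v p) \<le> - \<kappa> * (p \<bullet> p)"
    using D unfolding lyapunov_form_def by blast
  obtain K where K: "K > 0" "\<And>X p. norm (X *v p :: real^'n) \<le> norm (X :: real^'n^'n) * norm p * K"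
    using bounded_bilinear.pos_bounded[OF bounded_bilinear_matrix_vector_mult] by blast
  have "((\<lambda>G. norm (D ** transpose (G - F))) \<longlongrightarrow> norm (D ** transpose (F - F))) (nhds F)"
    by (intro tendsto_norm bounded_bilinear.tendsto[OF bounded_bilinear_matrix_matrix_mult]
        bounded_linear.tendsto[OF bounded_linear_transpose] tendsto_intros filterlim_ident)
  then have "\<forall>\<^sub>F G in nhds F. norm (D ** transpose (G - F)) < \<kappa> / (2 * K)"
    by (rule order_tendstoD) (use \<kappa>(1) K(1) in \<open>simp add: transpose_zero\<close>)
  then show ?thesis
  proof eventually_elim
    case (elim G)
    define X where "X = D ** transpose (G - F)"
    have "p \<bullet> ((D ** transpose G) *v p) \<le> - (\<kappa> / 2) * (p \<bullet> p)" for p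
    proof -
      have "p \<bullet> (X *v p) \<le> norm p * norm (X *v p)"
        by (rule norm_cauchy_schwarz)
      also have "\<dots> \<le> norm p * (norm X * norm p * K)"
        by (intro mult_left_mono K) auto
      also have "\<dots> = norm X * K * (p \<bullet> p)"
        by (simp add: dot_square_norm power2_eq_square)
      also have "\<dots> \<le> \<kappa> / 2 * (p \<bullet> p)"
        using elim K(1) by (intro mult_right_mono) (auto simp: X_def field_simps)
      finally have "p \<bullet> (X *v p) \<le> \<kappa> / 2 * (p \<bullet> p)" .
      moreover have "D ** transpose G = D ** transpose F + X"
        by (simp add: X_def transpose_diff matrix_add_ldistrib[symmetric])
      then have "p \<bullet> ((D ** transpose G) *v p) = p \<bullet> ((D ** transpose F) *v p) + p \<bullet> (X *v p)"
        by (simp add: matrix_vector_mult_add_rdistrib inner_add_right)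
      ultimately show ?thesis using \<kappa>(2)[of p] by (simp add: algebra_simps)
    qed
    moreover have "\<kappa> / 2 > 0" using \<kappa>(1) by simp
    ultimately show ?case
      using D unfolding lyapunov_form_def by blast
  qed
qed

text \<open>The left side is the derivative of p . S q when p and q both follow the dual
  flow.\<close>

lemma lyapunov_inner:
  fixes F S :: "real^'n::finite^'n"
  shows "(transpose F *v p) \<bullet> (S *v q) + p \<bullet> (S *v (transpose F *v q))
    = p \<bullet> ((F ** S + S ** transpose F) *v q)"
  using inner_matrix_vector_mult_transpose[of p F "S *v q"]
  by (simp add: matrix_vector_mult_add_rdistrib inner_add_right matrix_vector_mul_assoc
      del: transpose_matrix_vector)

text \<open>The homogeneous equation makes p . X q constant along the dual flow, while the decay of
  that flow forces the limit 0.\<close>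

lemma lyapunov_operator_injective:
  fixes F X :: "real^'n::finite^'n"
  assumes D: "lyapunov_form D F" and X: "F ** X + X ** transpose F = 0"
  shows "X = 0"
proof -
  obtain \<Phi> where \<Phi>: "fundamental_matrix F \<Phi>"
    using fundamental_matrix_exists by blast
  have "p \<bullet> (X *v q) = 0" for p q
  proof -
    define g where "g t = (transpose (\<Phi> t) *v p) \<bullet> (X *v (transpose (\<Phi> t) *v q))" for t
    note dp = fundamental_matrix_transpose_derivative[OF \<Phi>]
    have "(g has_vector_derivative 0) (at t within UNIV)" for t
      unfolding g_def
      using bounded_bilinear.has_vector_derivative[OF bounded_bilinear_inner dp[where c=p and t=t]
          bounded_linear.has_vector_derivative[OF matrix_vector_mul_bounded_linear dp[where c=q and t=t], of X]]
        lyapunov_inner[of F "transpose (\<Phi> t) *v p" X "transpose (\<Phi> t) *v q"]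
      by (simp add: X add.commute del: transpose_matrix_vector)
    then obtain r where r: "g t = r" for t
      using has_vector_derivative_zero_constant[of UNIV g] by auto
    have "(g \<longlongrightarrow> 0 \<bullet> (X *v 0)) at_top"
      unfolding g_def
      by (intro tendsto_inner lyapunov_form_decay[OF \<Phi> D]
          bounded_linear.tendsto[OF matrix_vector_mul_bounded_linear])
    then have "((\<lambda>t. r) \<longlongrightarrow> 0) (at_top :: real filter)"
      by (simp add: r[abs_def])
    then have "r = 0"
      by (simp add: tendsto_const_iff)
    with r[of 0] show ?thesis
      by (simp add: g_def fundamental_matrix_0[OF \<Phi>])
  qed
  then have "X *v q = 0" for q
    using inner_eq_zero_iff by blast
  then show ?thesis
    by (simp add: matrix_eq)
qed

lemma linear_lyapunov_operator:
  "linear (\<lambda>X :: real^'n^'n. F ** X + X ** transpose F)" for F :: "real^'n::finite^'n"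
  by (intro bounded_linear.linear bounded_linear_add bounded_linear_ident
      bounded_bilinear.bounded_linear_left[OF bounded_bilinear_matrix_matrix_mult]
      bounded_bilinear.bounded_linear_right[OF bounded_bilinear_matrix_matrix_mult])

lemma inj_lyapunov_operator:
  fixes F :: "real^'n::finite^'n"
  assumes "lyapunov_form D F"
  shows "inj (\<lambda>X. F ** X + X ** transpose F)"
  unfolding linear_injective_0[OF linear_lyapunov_operator]
  using lyapunov_operator_injective[OF assms] by blast

text \<open>An injective linear operator on a finite-dimensional space is onto.\<close>

lemma lyapunov_equation_unique_solution:
  fixes F W :: "real^'n::finite^'n"
  assumes D: "lyapunov_form D F"
  shows "\<exists>!S. F ** S + S ** transpose F + W = 0"
proof -
  have "surj (\<lambda>X. F ** X + X ** transpose F)"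
    by (intro linear_injective_imp_surjective linear_lyapunov_operator inj_lyapunov_operator[OF D] refl)
  then obtain S where S: "- W = F ** S + S ** transpose F"
    by (rule surjE)
  have "T = S" if "F ** T + T ** transpose F + W = 0" for T
  proof (rule injD[OF inj_lyapunov_operator[OF D]])
    show "F ** T + T ** transpose F = F ** S + S ** transpose F"
      using that S by (metis add_eq_0_iff2)
  qed
  moreover have "F ** S + S ** transpose F + W = 0"
    unfolding S[symmetric] by simp
  ultimately show ?thesis by blast
qed

text \<open>The Lyapunov operator at F0 is injective, hence bounded below by some \<beta>.
  Subtracting the two equations therefore bounds S x - S0 by the perturbations of F and W.\<close>

lemma lyapunov_equation_solution_tendsto:
  fixes F0 :: "real^'n::finite^'n"
  assumes D: "lyapunov_form D F0" and S0: "F0 ** S0 + S0 ** transpose F0 + W0 = 0"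
    and F: "(F \<longlongrightarrow> F0) L" and W: "(W \<longlongrightarrow> W0) L"
    and S: "\<forall>\<^sub>F x in L. F x ** S x + S x ** transpose (F x) + W x = 0"
  shows "(S \<longlongrightarrow> S0) L"
proof -
  obtain \<beta> where \<beta>: "\<beta> > 0" "\<And>X. \<beta> * norm X \<le> norm (F0 ** X + X ** transpose F0)"
    using linear_inj_bounded_below_pos[OF linear_lyapunov_operator inj_lyapunov_operator[OF D]] by blast
  obtain K where K: "K > 0" "\<And>X Y. norm (X ** Y :: real^'n^'n) \<le> norm (X :: real^'n^'n) * norm (Y :: real^'n^'n) * K"
    using bounded_bilinear.pos_bounded[OF bounded_bilinear_matrix_matrix_mult] by blast
  define e where "e x = (norm (F x - F0) + norm (transpose (F x - F0))) * K" for x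
  have "(e \<longlongrightarrow> (norm (F0 - F0) + norm (transpose (F0 - F0))) * K) L"
    unfolding e_def
    by (intro tendsto_intros F bounded_linear.tendsto[OF bounded_linear_transpose])
  then have e: "(e \<longlongrightarrow> 0) L"
    by (simp add: transpose_zero)
  have "((\<lambda>x. (e x * norm S0 + norm (W x - W0)) * (2 / \<beta>)) \<longlongrightarrow> (0 * norm S0 + norm (W0 - W0)) * (2 / \<beta>)) L"
    by (intro tendsto_intros e W)
  then have lim: "((\<lambda>x. (e x * norm S0 + norm (W x - W0)) * (2 / \<beta>)) \<longlongrightarrow> 0) L"
    by simp
  have "\<forall>\<^sub>F x in L. e x < \<beta> / 2"
    by (rule order_tendstoD[OF e]) (use \<beta> in simp)
  with S have "\<forall>\<^sub>F x in L. norm (S x - S0) \<le> (e x * norm S0 + norm (W x - W0)) * (2 / \<beta>)"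
  proof eventually_elim
    case (elim x)
    let ?X = "S x - S0" and ?E = "F x - F0"
    have "F0 ** ?X + ?X ** transpose F0 = - (?E ** S x + S x ** transpose ?E + (W x - W0))"
    proof -
      have "F0 ** ?X + ?X ** transpose F0 + (?E ** S x + S x ** transpose ?E)
          = (F x ** S x + S x ** transpose (F x)) - (F0 ** S0 + S0 ** transpose F0)"
        by (simp add: transpose_diff
            bounded_bilinear.diff_left[OF bounded_bilinear_matrix_matrix_mult]
            bounded_bilinear.diff_right[OF bounded_bilinear_matrix_matrix_mult])
      also have "\<dots> = - (W x - W0)"
        using elim(1) S0 by (simp add: eq_neg_iff_add_eq_0[symmetric])
      finally have "F0 ** ?X + ?X ** transpose F0 + (?E ** S x + S x ** transpose ?E) = - (W x - W0)" .
      then have "F0 ** ?X + ?X ** transpose F0 = - (W x - W0) - (?E ** S x + S x ** transpose ?E)"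
        unfolding eq_diff_eq .
      also have "\<dots> = - (?E ** S x + S x ** transpose ?E + (W x - W0))"
        by simp
      finally show ?thesis .
    qed
    then have "\<beta> * norm ?X \<le> norm (?E ** S x + S x ** transpose ?E + (W x - W0))"
      using \<beta>(2)[of ?X] by (simp only: norm_minus_cancel)
    also have "\<dots> \<le> norm (?E ** S x) + norm (S x ** transpose ?E) + norm (W x - W0)"
      by (meson add_mono_thms_linordered_semiring(3) norm_triangle_ineq order_trans)
    also have "\<dots> \<le> e x * norm (S x) + norm (W x - W0)"
      using K(2)[of ?E "S x"] K(2)[of "S x" "transpose ?E"] by (simp add: e_def algebra_simps)
    \<comment> \<open>The unknown S x occurs in its own bound. Its deviation from S0 enters with a
      factor below \<beta> / 2 and is absorbed by the left side.\<close>
    also have "\<dots> \<le> e x * (norm S0 + norm ?X) + norm (W x - W0)"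
      using K(1) by (intro add_right_mono mult_left_mono norm_triangle_sub) (simp add: e_def)
    also have "\<dots> \<le> e x * norm S0 + \<beta> / 2 * norm ?X + norm (W x - W0)"
      using elim(2) mult_right_mono[of "e x" "\<beta> / 2" "norm ?X"] by (simp add: algebra_simps)
    finally show ?case
      using \<beta>(1) by (simp add: field_simps)
  qed
  then have "((\<lambda>x. norm (S x - S0)) \<longlongrightarrow> 0) L"
    by (intro tendsto_sandwich[OF _ _ tendsto_const lim]) auto
  then show ?thesis
    by (simp add: tendsto_norm_zero_iff LIM_zero_iff)
qed

section \<open>Integrals of square-integrable processes\<close>

lemma abs_mult_le_sum_squares: "\<bar>x * y\<bar> \<le> x\<^sup>2 + y\<^sup>2" for x y :: real
  using sum_squares_bound[of "\<bar>x\<bar>" "\<bar>y\<bar>"] mult_nonneg_nonneg[of "\<bar>x\<bar>" "\<bar>y\<bar>"]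
  unfolding abs_mult power2_abs by linarith

lemma integrable_mult_of_squares:
  fixes X Y :: "'a \<Rightarrow> real"
  assumes [measurable]: "X \<in> borel_measurable M" "Y \<in> borel_measurable M"
    and "integrable M (\<lambda>\<omega>. (X \<omega>)\<^sup>2)" "integrable M (\<lambda>\<omega>. (Y \<omega>)\<^sup>2)"
  shows "integrable M (\<lambda>\<omega>. X \<omega> * Y \<omega>)"
proof (rule Bochner_Integration.integrable_bound)
  show "integrable M (\<lambda>\<omega>. (X \<omega>)\<^sup>2 + (Y \<omega>)\<^sup>2)"
    using assms by simp
  show "AE \<omega> in M. norm (X \<omega> * Y \<omega>) \<le> norm ((X \<omega>)\<^sup>2 + (Y \<omega>)\<^sup>2)"
    using abs_mult_le_sum_squares by simp
qed measurable

lemma integrable_square_diff: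
  fixes X Y :: "'a \<Rightarrow> real"
  assumes [measurable]: "X \<in> borel_measurable M" "Y \<in> borel_measurable M"
    and "integrable M (\<lambda>\<omega>. (X \<omega>)\<^sup>2)" "integrable M (\<lambda>\<omega>. (Y \<omega>)\<^sup>2)"
  shows "integrable M (\<lambda>\<omega>. (X \<omega> - Y \<omega>)\<^sup>2)"
  unfolding power2_diff
  using assms integrable_mult_of_squares[OF assms] by (simp add: mult.assoc)

text \<open>With time rounded down to multiples of 1 / (n + 1) only countably many times occur,
  which gives joint measurability; path continuity then yields the process as a pointwise
  limit.\<close>

lemma borel_measurable_continuous_process:
  fixes Z :: "real \<Rightarrow> 'w \<Rightarrow> real"
  assumes Z: "\<And>s. Z s \<in> borel_measurable M"
    and cont: "\<And>\<omega>. \<omega> \<in> space M \<Longrightarrow> continuous_on UNIV (\<lambda>s. Z s \<omega>)"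
  shows "(\<lambda>(s, \<omega>). Z s \<omega>) \<in> borel_measurable (lborel \<Otimes>\<^sub>M M)"
proof -
  define r where "r n s = real_of_int \<lfloor>real (Suc n) * s\<rfloor> / real (Suc n)" for n s
  have r: "(\<lambda>n. r n s) \<longlonglongrightarrow> s" for s
  proof (rule tendsto_sandwich)
    have "s - 1 / real (Suc n) \<le> r n s" for n
    proof -
      have "(real (Suc n) * s - 1) / real (Suc n) \<le> r n s"
        unfolding r_def by (intro divide_right_mono) linarith+
      then show ?thesis by (simp add: diff_divide_distrib del: of_nat_Suc)
    qed
    then show "\<forall>\<^sub>F n in sequentially. s - 1 / real (Suc n) \<le> r n s"
      by simp
    show "\<forall>\<^sub>F n in sequentially. r n s \<le> s"
      by (intro always_eventually allI) (simp add: r_def field_simps del: of_nat_Suc)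
    show "(\<lambda>n. s - 1 / real (Suc n)) \<longlonglongrightarrow> s"
      using tendsto_diff[OF tendsto_const LIMSEQ_Suc[OF lim_1_over_n], of s] by simp
  qed simp
  have "(\<lambda>x. Z (r n (fst x)) (snd x)) \<in> borel_measurable (lborel \<Otimes>\<^sub>M M)" for n
    unfolding r_def
    by (rule measurable_compose_countable[where f="\<lambda>i x. Z (real_of_int i / real (Suc n)) (snd x)"
          and g="\<lambda>x. \<lfloor>real (Suc n) * fst x\<rfloor>"]) (use Z in measurable)
  moreover have "(\<lambda>n. Z (r n (fst x)) (snd x)) \<longlonglongrightarrow> Z (fst x) (snd x)"
    if "x \<in> space (lborel \<Otimes>\<^sub>M M)" for x
    using cont[of "snd x"] that
    by (intro continuous_on_tendsto_compose[OF _ r]) (auto simp: space_pair_measure)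
  ultimately show ?thesis
    unfolding case_prod_beta' by (rule borel_measurable_LIMSEQ_real[rotated])
qed

text \<open>Cauchy-Schwarz against the constant 1, read off from the nonnegative integral of (z -
  m)^2, where m is the mean value of z.\<close>

lemma square_integral_le:
  fixes z :: "real \<Rightarrow> real"
  assumes z: "continuous_on {0..t} z" and t: "t \<ge> 0"
  shows "(integral {0..t} z)\<^sup>2 \<le> t * integral {0..t} (\<lambda>s. (z s)\<^sup>2)"
proof (cases "t = 0")
  case False
  define m where "m = integral {0..t} z / t"
  have i: "z integrable_on {0..t}" "(\<lambda>s. (z s)\<^sup>2) integrable_on {0..t}"
    by (intro integrable_continuous_real continuous_intros z)+
  have "((\<lambda>s. (z s)\<^sup>2 - 2 * m * z s + m\<^sup>2) has_integral
      integral {0..t} (\<lambda>s. (z s)\<^sup>2) - 2 * m * integral {0..t} z + t * m\<^sup>2) {0..t}"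
    using has_integral_const_real[of "m\<^sup>2" 0 t] t
    by (intro has_integral_add has_integral_diff has_integral_mult_right integrable_integral i) simp_all
  then have "0 \<le> integral {0..t} (\<lambda>s. (z s)\<^sup>2) - 2 * m * integral {0..t} z + t * m\<^sup>2"
  proof (rule has_integral_nonneg)
    show "0 \<le> (z s)\<^sup>2 - 2 * m * z s + m\<^sup>2" for s
      using zero_le_power2[of "z s - m"] by (simp add: power2_diff mult_ac)
  qed
  also have "\<dots> = integral {0..t} (\<lambda>s. (z s)\<^sup>2) - (integral {0..t} z)\<^sup>2 / t"
    using False by (simp add: m_def field_simps power2_eq_square)
  finally show ?thesis using False t by (simp add: field_simps)
qed simp

context prob_space
begin

text \<open>A bound on the first absolute moments that is uniform in s is enough for Fubini, the
  time interval being bounded.\<close>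

lemma integrable_pair_indicator:
  fixes U :: "real \<times> 'a \<Rightarrow> real"
  assumes U [measurable]: "U \<in> borel_measurable (lborel \<Otimes>\<^sub>M M)"
    and int: "\<And>s. s \<in> {0..t} \<Longrightarrow> integrable M (\<lambda>\<omega>. U (s, \<omega>))"
    and bound: "\<And>s. s \<in> {0..t} \<Longrightarrow> expectation (\<lambda>\<omega>. \<bar>U (s, \<omega>)\<bar>) \<le> K"
  shows "integrable (lborel \<Otimes>\<^sub>M M) (\<lambda>(s, \<omega>). indicator {0..t} s * U (s, \<omega>))"
proof -
  interpret pair_sigma_finite lborel M ..
  show ?thesis
  proof (rule Fubini_integrable)
    show "integrable lborel (\<lambda>s. \<integral>\<omega>. norm (case (s, \<omega>) of (s, \<omega>) \<Rightarrow> indicator {0..t} s * U (s, \<omega>)) \<partial>M)"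
    proof (rule Bochner_Integration.integrable_bound)
      show "integrable lborel (\<lambda>s. indicator {0..t} s * K)"
        by (intro integrable_mult_left integrable_real_indicator) (auto simp: emeasure_lborel_Icc_eq)
      show "AE s in lborel. norm (\<integral>\<omega>. norm (case (s, \<omega>) of (s, \<omega>) \<Rightarrow> indicator {0..t} s * U (s, \<omega>)) \<partial>M)
          \<le> norm (indicator {0..t} s * K)"
        using order_trans[OF bound abs_ge_self] by (auto simp: abs_mult indicator_def)
    qed measurable
    show "AE s in lborel. integrable M (\<lambda>\<omega>. case (s, \<omega>) of (s, \<omega>) \<Rightarrow> indicator {0..t} s * U (s, \<omega>))"
      using int by (auto simp: indicator_def)
  qed measurable
qed

context
  fixes Z :: "real \<Rightarrow> 'a \<Rightarrow> real" and t K :: real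
  assumes t: "t \<ge> 0"
    and Z: "\<And>s. s \<in> {0..t} \<Longrightarrow> Z s \<in> borel_measurable M"
    and cont: "\<And>\<omega>. \<omega> \<in> space M \<Longrightarrow> continuous_on {0..t} (\<lambda>s. Z s \<omega>)"
    and sq: "\<And>s. s \<in> {0..t} \<Longrightarrow> integrable M (\<lambda>\<omega>. (Z s \<omega>)\<^sup>2)"
    and bound: "\<And>s. s \<in> {0..t} \<Longrightarrow> expectation (\<lambda>\<omega>. (Z s \<omega>)\<^sup>2) \<le> K"
begin

text \<open>Z is controlled on [0, t] only; freezing time at the endpoints makes its paths
  continuous on the whole line.\<close>

lemma clamped_process_measurable:
  "(\<lambda>(s, \<omega>). Z (max 0 (min t s)) \<omega>) \<in> borel_measurable (lborel \<Otimes>\<^sub>M M)"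
proof (rule borel_measurable_continuous_process)
  show "Z (max 0 (min t s)) \<in> borel_measurable M" for s
    using t by (intro Z) auto
  show "continuous_on UNIV (\<lambda>s. Z (max 0 (min t s)) \<omega>)" if "\<omega> \<in> space M" for \<omega>
    using t by (intro continuous_on_compose2[OF cont[OF that]] continuous_intros) auto
qed

lemma integral_process_eq:
  assumes "\<omega> \<in> space M"
  shows "integral {0..t} (\<lambda>s. Z s \<omega>) = (\<integral>s. indicator {0..t} s * Z (max 0 (min t s)) \<omega> \<partial>lborel)"
proof -
  have "set_integrable lborel {0..t} (\<lambda>s. Z s \<omega>)"
    by (rule borel_integrable_atLeastAtMost'[OF cont[OF assms]])
  then have "integral {0..t} (\<lambda>s. Z s \<omega>) = (LINT s:{0..t}|lborel. Z s \<omega>)"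
    by (rule set_borel_integral_eq_integral(2)[symmetric])
  also have "\<dots> = (\<integral>s. indicator {0..t} s * Z (max 0 (min t s)) \<omega> \<partial>lborel)"
    unfolding set_lebesgue_integral_def
    by (intro Bochner_Integration.integral_cong refl) (simp add: indicator_def)
  finally show ?thesis .
qed

lemma borel_measurable_integral_process:
  "(\<lambda>\<omega>. integral {0..t} (\<lambda>s. Z s \<omega>)) \<in> borel_measurable M"
proof -
  note [measurable] = clamped_process_measurable
  have "(\<lambda>\<omega>. \<integral>s. indicator {0..t} s * Z (max 0 (min t s)) \<omega> \<partial>lborel) \<in> borel_measurable M"
    by measurable
  then show ?thesis
    by (subst measurable_cong[OF integral_process_eq])
qed

text \<open>By \<open>square_integral_le\<close> the square is dominated by t times the time
  integral of Z^2, which is integrable by Fubini.\<close>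

lemma integrable_square_integral_process:
  "integrable M (\<lambda>\<omega>. (integral {0..t} (\<lambda>s. Z s \<omega>))\<^sup>2)"
proof -
  interpret P: pair_sigma_finite lborel M ..
  note [measurable] = clamped_process_measurable borel_measurable_integral_process
  let ?U = "\<lambda>(s, \<omega>). (Z (max 0 (min t s)) \<omega>)\<^sup>2"
  have "integrable (lborel \<Otimes>\<^sub>M M) (\<lambda>(s, \<omega>). indicator {0..t} s * ?U (s, \<omega>))"
  proof (rule integrable_pair_indicator[where K=K])
    show "?U \<in> borel_measurable (lborel \<Otimes>\<^sub>M M)" by measurable
  qed (use sq bound in auto)
  then have i: "integrable M (\<lambda>\<omega>. t * (\<integral>s. indicator {0..t} s * (Z (max 0 (min t s)) \<omega>)\<^sup>2 \<partial>lborel))"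
    using P.integrable_snd[of "\<lambda>s \<omega>. indicator {0..t} s * ?U (s, \<omega>)"] by simp
  show ?thesis
  proof (rule Bochner_Integration.integrable_bound[OF i])
    show "AE \<omega> in M. norm ((integral {0..t} (\<lambda>s. Z s \<omega>))\<^sup>2)
        \<le> norm (t * (\<integral>s. indicator {0..t} s * (Z (max 0 (min t s)) \<omega>)\<^sup>2 \<partial>lborel))"
    proof (rule AE_I2)
      fix \<omega> assume \<omega>: "\<omega> \<in> space M"
      have "set_integrable lborel {0..t} (\<lambda>s. (Z s \<omega>)\<^sup>2)"
        by (intro borel_integrable_atLeastAtMost' continuous_intros cont[OF \<omega>])
      then have "integral {0..t} (\<lambda>s. (Z s \<omega>)\<^sup>2) = (LINT s:{0..t}|lborel. (Z s \<omega>)\<^sup>2)"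
        by (rule set_borel_integral_eq_integral(2)[symmetric])
      also have "\<dots> = (\<integral>s. indicator {0..t} s * (Z (max 0 (min t s)) \<omega>)\<^sup>2 \<partial>lborel)"
        unfolding set_lebesgue_integral_def
        by (intro Bochner_Integration.integral_cong refl) (simp add: indicator_def)
      finally have "integral {0..t} (\<lambda>s. (Z s \<omega>)\<^sup>2) = (\<integral>s. indicator {0..t} s * (Z (max 0 (min t s)) \<omega>)\<^sup>2 \<partial>lborel)" .
      with square_integral_le[OF cont[OF \<omega>] t]
      show "norm ((integral {0..t} (\<lambda>s. Z s \<omega>))\<^sup>2)
        \<le> norm (t * (\<integral>s. indicator {0..t} s * (Z (max 0 (min t s)) \<omega>)\<^sup>2 \<partial>lborel))"
        by simp
    qed
  qed measurable
qed

text \<open>Fubini; the uniform bound comes from |X Z| <= X^2 + Z^2.\<close>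

lemma expectation_mult_integral_process:
  assumes X [measurable]: "X \<in> borel_measurable M" and X2: "integrable M (\<lambda>\<omega>. (X \<omega>)\<^sup>2)"
  shows "expectation (\<lambda>\<omega>. X \<omega> * integral {0..t} (\<lambda>s. Z s \<omega>))
    = integral {0..t} (\<lambda>s. expectation (\<lambda>\<omega>. X \<omega> * Z s \<omega>))"
proof -
  interpret P: pair_sigma_finite lborel M ..
  note [measurable] = clamped_process_measurable
  let ?Z = "\<lambda>s. Z (max 0 (min t s))"
  let ?g = "\<lambda>s \<omega>. indicator {0..t} s * (X \<omega> * ?Z s \<omega>)"
  have clamp: "max 0 (min t s) = s" if "s \<in> {0..t}" for s
    using that by auto
  have i: "integrable (lborel \<Otimes>\<^sub>M M) (\<lambda>(s, \<omega>). indicator {0..t} s * (\<lambda>(s, \<omega>). X \<omega> * ?Z s \<omega>) (s, \<omega>))"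
  proof (rule integrable_pair_indicator[where K="expectation (\<lambda>\<omega>. (X \<omega>)\<^sup>2) + K"])
    fix s assume s: "s \<in> {0..t}"
    have XZ: "integrable M (\<lambda>\<omega>. X \<omega> * Z s \<omega>)"
      by (rule integrable_mult_of_squares[OF X Z[OF s] X2 sq[OF s]])
    then show "integrable M (\<lambda>\<omega>. (\<lambda>(s, \<omega>). X \<omega> * ?Z s \<omega>) (s, \<omega>))"
      by (simp add: clamp[OF s])
    have "expectation (\<lambda>\<omega>. \<bar>X \<omega> * Z s \<omega>\<bar>) \<le> expectation (\<lambda>\<omega>. (X \<omega>)\<^sup>2 + (Z s \<omega>)\<^sup>2)"
      using XZ X2 sq[OF s] abs_mult_le_sum_squares by (intro integral_mono) auto
    also have "\<dots> \<le> expectation (\<lambda>\<omega>. (X \<omega>)\<^sup>2) + K"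
      using X2 sq[OF s] bound[OF s] by simp
    finally show "expectation (\<lambda>\<omega>. \<bar>(\<lambda>(s, \<omega>). X \<omega> * ?Z s \<omega>) (s, \<omega>)\<bar>) \<le> expectation (\<lambda>\<omega>. (X \<omega>)\<^sup>2) + K"
      by (simp add: clamp[OF s])
  qed measurable
  then have i: "integrable (lborel \<Otimes>\<^sub>M M) (case_prod ?g)"
    by simp
  have "expectation (\<lambda>\<omega>. X \<omega> * integral {0..t} (\<lambda>s. Z s \<omega>)) = (\<integral>\<omega>. \<integral>s. ?g s \<omega> \<partial>lborel \<partial>M)"
    by (intro Bochner_Integration.integral_cong refl)
      (simp add: integral_process_eq mult.left_commute[of "indicator _ _"])
  also have "\<dots> = (\<integral>s. \<integral>\<omega>. ?g s \<omega> \<partial>M \<partial>lborel)"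
    by (rule P.Fubini_integral[OF i])
  also have "\<dots> = (LINT s:{0..t}|lborel. expectation (\<lambda>\<omega>. X \<omega> * Z s \<omega>))"
    unfolding set_lebesgue_integral_def
    by (intro Bochner_Integration.integral_cong refl) (auto simp: indicator_def)
  also have "\<dots> = integral {0..t} (\<lambda>s. expectation (\<lambda>\<omega>. X \<omega> * Z s \<omega>))"
  proof (rule set_borel_integral_eq_integral(2))
    have "integrable lborel (\<lambda>s. \<integral>\<omega>. ?g s \<omega> \<partial>M)"
      by (rule P.integrable_fst[OF i])
    then show "set_integrable lborel {0..t} (\<lambda>s. expectation (\<lambda>\<omega>. X \<omega> * Z s \<omega>))"
      unfolding set_integrable_def
      by (rule Bochner_Integration.integrable_cong[THEN iffD1, rotated -1]) (auto simp: indicator_def)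
  qed
  finally show ?thesis .
qed

end

end

section \<open>Second moments of linear responses\<close>

text \<open>The Brownian kernel is linear up to r and constant afterwards: integration by parts on
  [0, r], the fundamental theorem on [r, t].\<close>

lemma min_mult_by_parts:
  fixes k k' :: "real \<Rightarrow> real"
  assumes r: "r \<in> {0..t}"
    and k: "\<And>s. s \<in> {0..t} \<Longrightarrow> (k has_vector_derivative k' s) (at s within {0..t})"
  shows "((\<lambda>s. min s r * k' s) has_integral (r * k t - integral {0..r} k)) {0..t}"
proof -
  have kr: "(k has_vector_derivative k' s) (at s within {0..r})" if "s \<in> {0..r}" for s
    using k[of s] r that by (auto intro: has_vector_derivative_within_subset)
  have "((\<lambda>s. s * k s) has_vector_derivative k s + s * k' s) (at s within {0..r})" if "s \<in> {0..r}" for s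
    using has_vector_derivative_mult[OF has_vector_derivative_id kr[OF that]] by (simp add: add.commute)
  from fundamental_theorem_of_calculus[OF _ this] r
  have 1: "((\<lambda>s. k s + s * k' s) has_integral r * k r) {0..r}" by simp
  have "(k has_integral integral {0..r} k) {0..r}"
    by (intro integrable_integral integrable_continuous_real continuous_on_vector_derivative[OF kr])
  from has_integral_diff[OF 1 this]
  have "((\<lambda>s. s * k' s) has_integral r * k r - integral {0..r} k) {0..r}" by simp
  then have left: "((\<lambda>s. min s r * k' s) has_integral r * k r - integral {0..r} k) {0..r}"
    by (rule has_integral_eq[rotated]) auto
  have "(k' has_integral k t - k r) {r..t}"
    using r by (intro fundamental_theorem_of_calculus has_vector_derivative_within_subset[OF k]) auto
  from has_integral_mult_right[OF this, of r]
  have right: "((\<lambda>s. min s r * k' s) has_integral r * (k t - k r)) {r..t}"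
    by (rule has_integral_eq[rotated]) auto
  from has_integral_combine[OF _ _ left right] r show ?thesis
    by (simp add: algebra_simps)
qed

text \<open>This weaker property of the noise is easy to check for the joint noise (w, B v), whose
  covariance may be singular.\<close>

definition brownian_second_moments ::
  "'w measure \<Rightarrow> real^'n^'n \<Rightarrow> (real \<Rightarrow> 'w \<Rightarrow> real^'n) \<Rightarrow> bool" where
  "brownian_second_moments M W b \<longleftrightarrow>
     (\<forall>t\<ge>0. b t \<in> borel_measurable M) \<and>
     (\<forall>\<omega>\<in>space M. continuous_on {0..} (\<lambda>t. b t \<omega>)) \<and>
     (\<forall>t\<ge>0. \<forall>u. integrable M (\<lambda>\<omega>. (u \<bullet> b t \<omega>)\<^sup>2)) \<and>
     (\<forall>s\<ge>0. \<forall>r\<ge>0. \<forall>u a. integral\<^sup>L M (\<lambda>\<omega>. (u \<bullet> b s \<omega>) * (a \<bullet> b r \<omega>)) = min s r * (u \<bullet> (W *v a)))"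

context prob_space
begin

text \<open>The random variable is the Wiener integral of h against b, written pathwise by parts;
  the second claim is its Ito isometry.\<close>

lemma second_moment_integral_by_parts:
  fixes h h' :: "real \<Rightarrow> real^'n::finite" and b :: "real \<Rightarrow> 'a \<Rightarrow> real^'n"
  assumes b: "brownian_second_moments M W b" and t: "t \<ge> 0"
    and h: "\<And>s. s \<in> {0..t} \<Longrightarrow> (h has_vector_derivative h' s) (at s within {0..t})"
    and h': "continuous_on {0..t} h'"
  shows "integrable M (\<lambda>\<omega>. (h t \<bullet> b t \<omega> - integral {0..t} (\<lambda>s. h' s \<bullet> b s \<omega>))\<^sup>2)" (is ?integrable)
    and "expectation (\<lambda>\<omega>. (h t \<bullet> b t \<omega> - integral {0..t} (\<lambda>s. h' s \<bullet> b s \<omega>))\<^sup>2)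
      = integral {0..t} (\<lambda>s. h s \<bullet> (W *v h s))" (is ?isometry)
proof -
  have meas [measurable]: "s \<ge> 0 \<Longrightarrow> b s \<in> borel_measurable M" for s
    using b unfolding brownian_second_moments_def by auto
  have paths: "\<omega> \<in> space M \<Longrightarrow> continuous_on {0..} (\<lambda>t. b t \<omega>)" for \<omega>
    using b unfolding brownian_second_moments_def by auto
  have sq: "s \<ge> 0 \<Longrightarrow> integrable M (\<lambda>\<omega>. (u \<bullet> b s \<omega>)\<^sup>2)" for s u
    using b unfolding brownian_second_moments_def by auto
  have cov: "s \<ge> 0 \<Longrightarrow> r \<ge> 0 \<Longrightarrow>
      expectation (\<lambda>\<omega>. (u \<bullet> b s \<omega>) * (a \<bullet> b r \<omega>)) = min s r * (u \<bullet> (W *v a))" for s r u a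
    using b unfolding brownian_second_moments_def by auto
  have ch: "continuous_on {0..t} h"
    by (rule continuous_on_vector_derivative[OF h])
  define Z where "Z s \<omega> = h' s \<bullet> b s \<omega>" for s \<omega>
  define Y where "Y \<omega> = integral {0..t} (\<lambda>s. Z s \<omega>)" for \<omega>
  define X where "X \<omega> = h t \<bullet> b t \<omega>" for \<omega>
  define J where "J \<omega> = X \<omega> - Y \<omega>" for \<omega>
  have Zm: "Z s \<in> borel_measurable M" if "s \<in> {0..t}" for s
    unfolding Z_def by (intro borel_measurable_inner borel_measurable_const meas) (use that in simp)
  have Zc: "continuous_on {0..t} (\<lambda>s. Z s \<omega>)" if "\<omega> \<in> space M" for \<omega>
    unfolding Z_def
    by (intro continuous_intros h' continuous_on_subset[OF paths[OF that]]) auto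
  have Zsq: "integrable M (\<lambda>\<omega>. (Z s \<omega>)\<^sup>2)" if "s \<in> {0..t}" for s
    using sq[of s] that unfolding Z_def by simp
  have "continuous_on {0..t} (\<lambda>s. s * (h' s \<bullet> (W *v h' s)))"
    by (intro continuous_intros h')
  then have "bounded ((\<lambda>s. s * (h' s \<bullet> (W *v h' s))) ` {0..t})"
    by (intro compact_imp_bounded compact_continuous_image compact_Icc)
  then obtain K where "norm x \<le> K" if "x \<in> (\<lambda>s. s * (h' s \<bullet> (W *v h' s))) ` {0..t}" for x
    unfolding bounded_iff by blast
  then have K: "s * (h' s \<bullet> (W *v h' s)) \<le> K" if "s \<in> {0..t}" for s
    using that by fastforce
  have Zb: "expectation (\<lambda>\<omega>. (Z s \<omega>)\<^sup>2) \<le> K" if "s \<in> {0..t}" for s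
    using cov[of s s "h' s" "h' s"] K[OF that] that by (simp add: Z_def power2_eq_square)
  note process = t Zm Zc Zsq Zb
  have Xm [measurable]: "X \<in> borel_measurable M"
    using t unfolding X_def by measurable
  have Xsq: "integrable M (\<lambda>\<omega>. (X \<omega>)\<^sup>2)"
    using sq[OF t] by (simp add: X_def)
  have Ym [measurable]: "Y \<in> borel_measurable M"
    unfolding Y_def by (rule borel_measurable_integral_process[OF process])
  have Ysq: "integrable M (\<lambda>\<omega>. (Y \<omega>)\<^sup>2)"
    unfolding Y_def by (rule integrable_square_integral_process[OF process])
  have Jm [measurable]: "J \<in> borel_measurable M"
    unfolding J_def by measurable
  have Jsq: "integrable M (\<lambda>\<omega>. (J \<omega>)\<^sup>2)"
    unfolding J_def by (rule integrable_square_diff[OF Xm Ym Xsq Ysq])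
  define G where "G r = integral {0..r} h" for r
  \<comment> \<open>As for a stochastic integral, only the part of h before time r correlates with b
    r; the boundary terms r * ?k t cancel.\<close>
  have cross: "expectation (\<lambda>\<omega>. (u \<bullet> b r \<omega>) * J \<omega>) = u \<bullet> (W *v G r)" if r: "r \<in> {0..t}" for r u
  proof -
    let ?k = "\<lambda>s. u \<bullet> (W *v h s)" and ?k' = "\<lambda>s. u \<bullet> (W *v h' s)"
    have r0: "r \<ge> 0" using r by simp
    have bl: "bounded_linear (\<lambda>x. u \<bullet> (W *v x))"
      by (intro bounded_linear_inner_right_comp matrix_vector_mul_bounded_linear)
    have br: "(\<lambda>\<omega>. u \<bullet> b r \<omega>) \<in> borel_measurable M"
      using r0 by measurable
    have "expectation (\<lambda>\<omega>. (u \<bullet> b r \<omega>) * J \<omega>)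
        = expectation (\<lambda>\<omega>. (u \<bullet> b r \<omega>) * X \<omega>) - expectation (\<lambda>\<omega>. (u \<bullet> b r \<omega>) * Y \<omega>)"
      unfolding J_def right_diff_distrib
      by (intro Bochner_Integration.integral_diff integrable_mult_of_squares br Xm Ym Xsq Ysq sq r0)
    also have "expectation (\<lambda>\<omega>. (u \<bullet> b r \<omega>) * X \<omega>) = r * ?k t"
      unfolding X_def using cov[OF r0 t] r by simp
    also have "expectation (\<lambda>\<omega>. (u \<bullet> b r \<omega>) * Y \<omega>)
        = integral {0..t} (\<lambda>s. expectation (\<lambda>\<omega>. (u \<bullet> b r \<omega>) * Z s \<omega>))"
      unfolding Y_def by (rule expectation_mult_integral_process[OF process br sq[OF r0]])
    also have "\<dots> = integral {0..t} (\<lambda>s. min s r * ?k' s)"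
      by (rule Henstock_Kurzweil_Integration.integral_cong) (simp add: Z_def cov r0 min.commute)
    also have "\<dots> = r * ?k t - integral {0..r} ?k"
      by (intro integral_unique min_mult_by_parts[OF r] bounded_linear.has_vector_derivative[OF bl] h)
    also have "integral {0..r} ?k = u \<bullet> (W *v G r)"
      unfolding G_def
      by (rule integral_linear[OF _ bl, unfolded o_def])
        (use r in \<open>auto intro!: integrable_continuous_real continuous_on_subset[OF ch]\<close>)
    finally show ?thesis by simp
  qed
  have JY: "expectation (\<lambda>\<omega>. J \<omega> * Y \<omega>) = integral {0..t} (\<lambda>s. h' s \<bullet> (W *v G s))"
  proof -
    have "expectation (\<lambda>\<omega>. J \<omega> * Y \<omega>) = integral {0..t} (\<lambda>s. expectation (\<lambda>\<omega>. J \<omega> * Z s \<omega>))"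
      unfolding Y_def by (rule expectation_mult_integral_process[OF process Jm Jsq])
    also have "\<dots> = integral {0..t} (\<lambda>s. h' s \<bullet> (W *v G s))"
      by (rule Henstock_Kurzweil_Integration.integral_cong) (simp add: Z_def cross mult.commute[of "J _"])
    finally show ?thesis .
  qed
  \<comment> \<open>Only one factor J is expanded, so that \<open>cross\<close> evaluates both
    products: at time t for X, and under the time integral for Y.\<close>
  have "expectation (\<lambda>\<omega>. (J \<omega>)\<^sup>2) = expectation (\<lambda>\<omega>. X \<omega> * J \<omega> - J \<omega> * Y \<omega>)"
    by (intro Bochner_Integration.integral_cong refl) (simp add: J_def power2_eq_square algebra_simps)
  also have "\<dots> = expectation (\<lambda>\<omega>. X \<omega> * J \<omega>) - expectation (\<lambda>\<omega>. J \<omega> * Y \<omega>)"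
    by (intro Bochner_Integration.integral_diff integrable_mult_of_squares Xm Ym Jm Xsq Ysq Jsq)
  also have "expectation (\<lambda>\<omega>. X \<omega> * J \<omega>) = h t \<bullet> (W *v G t)"
    unfolding X_def using t by (intro cross) simp
  also have "\<dots> - expectation (\<lambda>\<omega>. J \<omega> * Y \<omega>) = integral {0..t} (\<lambda>s. h s \<bullet> (W *v h s))"
  proof -
    have dG: "(G has_vector_derivative h s) (at s within {0..t})" if "s \<in> {0..t}" for s
      unfolding G_def by (rule integral_has_vector_derivative[OF ch that])
    \<comment> \<open>The two summands are the desired integrand and the integrand of
      \<open>JY\<close>; the boundary value at 0 vanishes because G 0 = 0.\<close>
    have "((\<lambda>s. h s \<bullet> (W *v G s)) has_vector_derivative h s \<bullet> (W *v h s) + h' s \<bullet> (W *v G s))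
        (at s within {0..t})" if "s \<in> {0..t}" for s
      by (rule bounded_bilinear.has_vector_derivative[OF bounded_bilinear_inner h[OF that]
            bounded_linear.has_vector_derivative[OF matrix_vector_mul_bounded_linear dG[OF that]]])
    from integral_unique[OF fundamental_theorem_of_calculus[OF t this]]
    have "integral {0..t} (\<lambda>s. h s \<bullet> (W *v h s) + h' s \<bullet> (W *v G s)) = h t \<bullet> (W *v G t)"
      by (simp add: G_def)
    moreover have "continuous_on {0..t} G"
      by (rule continuous_on_vector_derivative[OF dG])
    then have "integral {0..t} (\<lambda>s. h s \<bullet> (W *v h s) + h' s \<bullet> (W *v G s))
        = integral {0..t} (\<lambda>s. h s \<bullet> (W *v h s)) + integral {0..t} (\<lambda>s. h' s \<bullet> (W *v G s))"
      by (intro Henstock_Kurzweil_Integration.integral_add integrable_continuous_real continuous_intros ch h')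
    ultimately show ?thesis by (simp add: JY)
  qed
  finally show ?isometry
    by (simp add: J_def X_def Y_def Z_def)
  show ?integrable
    using Jsq by (simp add: J_def X_def Y_def Z_def)
qed

text \<open>The subtracted term is the exact transient at time t, caused by starting at 0 instead of
  in the stationary regime.\<close>

lemma response_second_moment:
  fixes F :: "real^'n::finite^'n" and b \<xi> :: "real \<Rightarrow> 'a \<Rightarrow> real^'n"
  assumes \<Phi>: "fundamental_matrix F \<Phi>"
    and b: "brownian_second_moments M W b" and t: "t \<ge> 0"
    and S: "F ** S + S ** transpose F + W = 0"
    and \<xi>: "\<And>\<omega>. \<omega> \<in> space M \<Longrightarrow> continuous_on {0..} (\<lambda>t. \<xi> t \<omega>)"
    and eq: "\<And>\<omega> t. \<omega> \<in> space M \<Longrightarrow> t \<ge> 0 \<Longrightarrow> \<xi> t \<omega> = integral {0..t} (\<lambda>s. F *v \<xi> s \<omega>) + b t \<omega>"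
  shows "integrable M (\<lambda>\<omega>. (c \<bullet> \<xi> t \<omega>)\<^sup>2)"
    and "expectation (\<lambda>\<omega>. (c \<bullet> \<xi> t \<omega>)\<^sup>2)
    = c \<bullet> (S *v c) - (transpose (\<Phi> t) *v c) \<bullet> (S *v (transpose (\<Phi> t) *v c))"
proof -
  define h where "h s = transpose (\<Phi> t ** \<Phi> (- s)) *v c" for s
  have dh: "(h has_vector_derivative - (transpose F *v h s)) (at s within {0..t})" for s
  proof -
    have "((\<lambda>s. \<Phi> t ** \<Phi> (- s)) has_vector_derivative \<Phi> t ** - (\<Phi> (- s) ** F)) (at s within {0..t})"
      by (rule bounded_linear.has_vector_derivative[OF
            bounded_bilinear.bounded_linear_right[OF bounded_bilinear_matrix_matrix_mult]
            fundamental_matrix_derivative_neg[OF \<Phi>]])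
    from bounded_linear.has_vector_derivative[OF bounded_bilinear.bounded_linear_left[OF
          bounded_bilinear_matrix_vector_mult] bounded_linear.has_vector_derivative[OF
          bounded_linear_transpose this]]
    have "(h has_vector_derivative transpose (\<Phi> t ** - (\<Phi> (- s) ** F)) *v c) (at s within {0..t})"
      unfolding h_def .
    moreover have "\<Phi> t ** - (\<Phi> (- s) ** F) = - (\<Phi> t ** \<Phi> (- s) ** F)"
      by (simp add: bounded_bilinear.minus_right[OF bounded_bilinear_matrix_matrix_mult] matrix_mul_assoc)
    moreover have "transpose (- (\<Phi> t ** \<Phi> (- s) ** F)) *v c = - (transpose F *v h s)"
      by (simp add: h_def linear_neg[OF bounded_linear.linear[OF bounded_linear_transpose]]
          matrix_transpose_mul matrix_vector_mul_assoc
          bounded_bilinear.minus_left[OF bounded_bilinear_matrix_vector_mult] del: transpose_matrix_vector)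
    ultimately show ?thesis by simp
  qed
  have ch: "continuous_on {0..t} h"
    by (rule continuous_on_vector_derivative) (rule dh)
  have ht: "h t = c"
    by (simp add: h_def fundamental_matrix_inverse[OF \<Phi>])
  have h0: "h 0 = transpose (\<Phi> t) *v c"
    by (simp add: h_def fundamental_matrix_0[OF \<Phi>])
  have path: "c \<bullet> \<xi> t \<omega> = h t \<bullet> b t \<omega> - integral {0..t} (\<lambda>s. (- (transpose F *v h s)) \<bullet> b s \<omega>)"
    if \<omega>: "\<omega> \<in> space M" for \<omega>
  proof -
    have cb: "continuous_on {0..} (\<lambda>s. b s \<omega>)"
      using b \<omega> by (simp add: brownian_second_moments_def)
    have "c \<bullet> \<xi> t \<omega> = c \<bullet> b t \<omega> + c \<bullet> (\<Phi> t *v integral {0..t} (\<lambda>s. \<Phi> (- s) *v (F *v b s \<omega>)))"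
      using linear_response_unique[OF \<Phi> cb \<xi>[OF \<omega>] eq[OF \<omega>] t] by (simp add: inner_add_right)
    also have "c \<bullet> (\<Phi> t *v integral {0..t} (\<lambda>s. \<Phi> (- s) *v (F *v b s \<omega>)))
        = integral {0..t} (\<lambda>s. c \<bullet> (\<Phi> t *v (\<Phi> (- s) *v (F *v b s \<omega>))))"
    proof (rule integral_linear[symmetric, unfolded o_def])
      show "(\<lambda>s. \<Phi> (- s) *v (F *v b s \<omega>)) integrable_on {0..t}"
        by (intro integrable_continuous_real continuous_intros
            fundamental_matrix_neg_continuous[OF \<Phi>] continuous_on_subset[OF cb]) auto
      show "bounded_linear (\<lambda>x. c \<bullet> (\<Phi> t *v x))"
        by (intro bounded_linear_inner_right_comp matrix_vector_mul_bounded_linear)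
    qed
    also have "\<dots> = integral {0..t} (\<lambda>s. (transpose F *v h s) \<bullet> b s \<omega>)"
    proof (rule Henstock_Kurzweil_Integration.integral_cong)
      fix s
      show "c \<bullet> (\<Phi> t *v (\<Phi> (- s) *v (F *v b s \<omega>))) = (transpose F *v h s) \<bullet> b s \<omega>"
        using inner_matrix_vector_mult_transpose[of c "\<Phi> t ** \<Phi> (- s) ** F" "b s \<omega>"]
        by (simp add: h_def matrix_transpose_mul matrix_vector_mul_assoc matrix_mul_assoc
            del: transpose_matrix_vector)
    qed
    finally show ?thesis by (simp add: ht)
  qed
  have "integrable M (\<lambda>\<omega>. (h t \<bullet> b t \<omega> - integral {0..t} (\<lambda>s. (- (transpose F *v h s)) \<bullet> b s \<omega>))\<^sup>2)"
    by (intro second_moment_integral_by_parts(1)[OF b] t dh continuous_intros ch)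
  then show "integrable M (\<lambda>\<omega>. (c \<bullet> \<xi> t \<omega>)\<^sup>2)"
    by (rule Bochner_Integration.integrable_cong[THEN iffD1, rotated -1]) (simp_all add: path)
  have "expectation (\<lambda>\<omega>. (c \<bullet> \<xi> t \<omega>)\<^sup>2)
      = expectation (\<lambda>\<omega>. (h t \<bullet> b t \<omega> - integral {0..t} (\<lambda>s. (- (transpose F *v h s)) \<bullet> b s \<omega>))\<^sup>2)"
    by (intro Bochner_Integration.integral_cong refl arg_cong[where f="\<lambda>x. x\<^sup>2"] path)
  also have "\<dots> = integral {0..t} (\<lambda>s. h s \<bullet> (W *v h s))"
    by (intro second_moment_integral_by_parts(2) b t dh continuous_intros ch)
  also have "\<dots> = h t \<bullet> (S *v h t) - h 0 \<bullet> (S *v h 0)"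
  proof (intro integral_unique fundamental_theorem_of_calculus t)
    fix s
    let ?g = "transpose F *v h s"
    have "((\<lambda>s. h s \<bullet> (S *v h s)) has_vector_derivative h s \<bullet> (S *v - ?g) + (- ?g) \<bullet> (S *v h s))
        (at s within {0..t})"
      by (intro bounded_bilinear.has_vector_derivative[OF bounded_bilinear_inner]
            bounded_linear.has_vector_derivative[OF matrix_vector_mul_bounded_linear] dh)
    moreover have "F ** S + S ** transpose F = - W"
      using S by (simp add: eq_neg_iff_add_eq_0)
    then have "h s \<bullet> (S *v - ?g) + (- ?g) \<bullet> (S *v h s) = h s \<bullet> (W *v h s)"
      using lyapunov_inner[of F "h s" S "h s"]
      by (simp add: bounded_bilinear.minus_right[OF bounded_bilinear_matrix_vector_mult]
          bounded_bilinear.minus_left[OF bounded_bilinear_matrix_vector_mult] del: transpose_matrix_vector)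
    ultimately show "((\<lambda>s. h s \<bullet> (S *v h s)) has_vector_derivative h s \<bullet> (W *v h s)) (at s within {0..t})"
      by simp
  qed
  finally show "expectation (\<lambda>\<omega>. (c \<bullet> \<xi> t \<omega>)\<^sup>2)
    = c \<bullet> (S *v c) - (transpose (\<Phi> t) *v c) \<bullet> (S *v (transpose (\<Phi> t) *v c))"
    by (simp only: ht h0)
qed

lemma response_second_moment_tendsto:
  fixes F :: "real^'n::finite^'n" and b \<xi> :: "real \<Rightarrow> 'a \<Rightarrow> real^'n"
  assumes D: "lyapunov_form D F"
    and b: "brownian_second_moments M W b"
    and S: "F ** S + S ** transpose F + W = 0"
    and \<xi>: "\<And>\<omega>. \<omega> \<in> space M \<Longrightarrow> continuous_on {0..} (\<lambda>t. \<xi> t \<omega>)"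
    and eq: "\<And>\<omega> t. \<omega> \<in> space M \<Longrightarrow> t \<ge> 0 \<Longrightarrow> \<xi> t \<omega> = integral {0..t} (\<lambda>s. F *v \<xi> s \<omega>) + b t \<omega>"
  shows "((\<lambda>t. expectation (\<lambda>\<omega>. (c \<bullet> \<xi> t \<omega>)\<^sup>2)) \<longlongrightarrow> c \<bullet> (S *v c)) at_top"
proof -
  obtain \<Phi> where \<Phi>: "fundamental_matrix F \<Phi>"
    using fundamental_matrix_exists by blast
  have "((\<lambda>t. c \<bullet> (S *v c) - (transpose (\<Phi> t) *v c) \<bullet> (S *v (transpose (\<Phi> t) *v c)))
      \<longlongrightarrow> c \<bullet> (S *v c) - 0 \<bullet> (S *v 0)) at_top"
    by (intro tendsto_diff tendsto_const tendsto_inner lyapunov_form_decay[OF \<Phi> D]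
        bounded_linear.tendsto[OF matrix_vector_mul_bounded_linear])
  moreover have "\<forall>\<^sub>F t in at_top. c \<bullet> (S *v c) - (transpose (\<Phi> t) *v c) \<bullet> (S *v (transpose (\<Phi> t) *v c))
      = expectation (\<lambda>\<omega>. (c \<bullet> \<xi> t \<omega>)\<^sup>2)"
    using response_second_moment(2)[OF \<Phi> b _ S \<xi> eq]
    by (intro eventually_mono[OF eventually_ge_at_top[of 0]]) simp
  ultimately show ?thesis
    by (auto intro: Lim_transform_eventually)
qed

end

section \<open>Brownian motions\<close>

context prob_space
begin

text \<open>Variance 0 does occur, for u = 0 or an empty time interval; the law is then a point
  mass, whence the case distinction.\<close>

lemma centered_gaussian_moments:
  assumes X: "centered_gaussian M X v" and v: "v \<ge> 0"
  shows "integrable M X" and "expectation X = 0"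
    and "integrable M (\<lambda>\<omega>. (X \<omega>)\<^sup>2)" and "expectation (\<lambda>\<omega>. (X \<omega>)\<^sup>2) = v"
proof -
  have Xm [measurable]: "X \<in> borel_measurable M"
    using X by (simp add: centered_gaussian_def)
  have "integrable M X \<and> expectation X = 0 \<and>
    integrable M (\<lambda>\<omega>. (X \<omega>)\<^sup>2) \<and> expectation (\<lambda>\<omega>. (X \<omega>)\<^sup>2) = v"
  proof (cases "v = 0")
    case True
    then have "distr M borel X = return borel 0"
      using X by (simp add: centered_gaussian_def)
    moreover have "AE x in return borel (0::real). x = 0"
      by (subst AE_return) simp_all
    ultimately have "AE x in distr M borel X. x = 0"
      by (simp only:)
    then have ae: "AE \<omega> in M. X \<omega> = 0"
      by (subst (asm) AE_distr_iff) simp_all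
    have "has_bochner_integral M X 0"
      by (rule has_bochner_integral_cong_AE[THEN iffD1, OF _ _ _ has_bochner_integral_zero])
        (use ae in auto)
    moreover have "has_bochner_integral M (\<lambda>\<omega>. (X \<omega>)\<^sup>2) 0"
      by (rule has_bochner_integral_cong_AE[THEN iffD1, OF _ _ _ has_bochner_integral_zero])
        (use ae in auto)
    ultimately show ?thesis
      using True by (auto dest: has_bochner_integral_integral_eq has_bochner_integral_integrable
          simp: has_bochner_integral_iff)
  next
    case False
    with v have s: "sqrt v > 0" by simp
    have d: "distr M borel X = density lborel (normal_density 0 (sqrt v))"
      using X False by (simp add: centered_gaussian_def)
    have *: "has_bochner_integral M (\<lambda>\<omega>. f (X \<omega>)) r"
      if [measurable]: "f \<in> borel_measurable borel"
        and "has_bochner_integral lborel (\<lambda>x. normal_density 0 (sqrt v) x * f x) r" for f and r :: real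
    proof -
      have "has_bochner_integral (density lborel (normal_density 0 (sqrt v))) f r"
        using that by (intro has_bochner_integral_density) (auto simp: s less_imp_le)
      then show ?thesis
        unfolding d[symmetric] has_bochner_integral_iff
        by (simp add: integrable_distr_eq integral_distr)
    qed
    have "has_bochner_integral M (\<lambda>\<omega>. X \<omega>) 0"
      using *[of "\<lambda>x. x", OF _ normal_moment_nz_1[OF s]] by simp
    moreover have "has_bochner_integral M (\<lambda>\<omega>. (X \<omega>)\<^sup>2) v"
    proof (rule *)
      show "has_bochner_integral lborel (\<lambda>x. normal_density 0 (sqrt v) x * x\<^sup>2) v"
        using normal_moment_even[OF s, of 0 1] v by (simp add: fact_numeral power_divide)
    qed simp
    ultimately show ?thesis
      by (simp add: has_bochner_integral_iff)
  qed
  then show "integrable M X" and "expectation X = 0"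
    and "integrable M (\<lambda>\<omega>. (X \<omega>)\<^sup>2)" and "expectation (\<lambda>\<omega>. (X \<omega>)\<^sup>2) = v"
    by blast+
qed

lemma brownian_motion_second_moments:
  fixes W :: "real^'n::finite^'n"
  assumes b: "brownian_motion M W b" and W: "posdef W"
  shows "brownian_second_moments M W b"
    and "\<And>t u. t \<ge> 0 \<Longrightarrow> integrable M (\<lambda>\<omega>. u \<bullet> b t \<omega>)"
    and "\<And>t u. t \<ge> 0 \<Longrightarrow> expectation (\<lambda>\<omega>. u \<bullet> b t \<omega>) = 0"
proof -
  have sym: "transpose W = W" and psd: "u \<bullet> (W *v u) \<ge> 0" for u
    using W by (cases "u = 0"; force simp: posdef_def less_imp_le)+
  have meas [measurable]: "t \<ge> 0 \<Longrightarrow> b t \<in> borel_measurable M" for t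
    using b unfolding brownian_motion_def by auto
  have b0: "\<omega> \<in> space M \<Longrightarrow> b 0 \<omega> = 0"
    and paths: "\<omega> \<in> space M \<Longrightarrow> continuous_on {0..} (\<lambda>t. b t \<omega>)" for \<omega>
    using b unfolding brownian_motion_def by auto
  have gauss: "0 \<le> s \<Longrightarrow> s \<le> t \<Longrightarrow>
      centered_gaussian M (\<lambda>\<omega>. u \<bullet> (b t \<omega> - b s \<omega>)) ((t - s) * (u \<bullet> (W *v u)))" for s t u
    using b unfolding brownian_motion_def by auto
  have indep: "0 \<le> \<tau> 0 \<Longrightarrow> incseq \<tau> \<Longrightarrow>
      indep_vars (\<lambda>_. borel) (\<lambda>i \<omega>. b (\<tau> (Suc i)) \<omega> - b (\<tau> i) \<omega>) UNIV" for \<tau> :: "nat \<Rightarrow> real"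
    using b unfolding brownian_motion_def by auto
  have incr: "integrable M (\<lambda>\<omega>. u \<bullet> (b t \<omega> - b s \<omega>))"
    "expectation (\<lambda>\<omega>. u \<bullet> (b t \<omega> - b s \<omega>)) = 0"
    "integrable M (\<lambda>\<omega>. (u \<bullet> (b t \<omega> - b s \<omega>))\<^sup>2)"
    "expectation (\<lambda>\<omega>. (u \<bullet> (b t \<omega> - b s \<omega>))\<^sup>2) = (t - s) * (u \<bullet> (W *v u))"
    if "0 \<le> s" "s \<le> t" for s t u
    using centered_gaussian_moments[OF gauss[OF that]] that psd by auto
  \<comment> \<open>The path starts at 0 on the sample space, so the increment from time 0 can be
    replaced by the value under the integral sign.\<close>
  have eq0: "integral\<^sup>L M (\<lambda>\<omega>. f (b t \<omega> - b 0 \<omega>)) = integral\<^sup>L M (\<lambda>\<omega>. f (b t \<omega>))"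
    "integrable M (\<lambda>\<omega>. f (b t \<omega> - b 0 \<omega>)) = integrable M (\<lambda>\<omega>. f (b t \<omega>))" for f :: "real^'n \<Rightarrow> real" and t
    by (intro Bochner_Integration.integral_cong Bochner_Integration.integrable_cong refl; simp add: b0)+
  have int: "integrable M (\<lambda>\<omega>. u \<bullet> b t \<omega>)"
    and mean: "expectation (\<lambda>\<omega>. u \<bullet> b t \<omega>) = 0"
    and sq: "integrable M (\<lambda>\<omega>. (u \<bullet> b t \<omega>)\<^sup>2)"
    and var: "expectation (\<lambda>\<omega>. (u \<bullet> b t \<omega>)\<^sup>2) = t * (u \<bullet> (W *v u))" if "t \<ge> 0" for t u
    using incr[OF order_refl that, of u] eq0[of "\<lambda>x. u \<bullet> x" t] eq0[of "\<lambda>x. (u \<bullet> x)\<^sup>2" t] by simp_all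
  have prod: "integrable M (\<lambda>\<omega>. (u \<bullet> b s \<omega>) * (a \<bullet> b t \<omega>))" if "s \<ge> 0" "t \<ge> 0" for s t u a
    using that by (intro integrable_mult_of_squares sq borel_measurable_inner borel_measurable_const meas)
  \<comment> \<open>Polarization of \<open>var\<close>, using the symmetry of W.\<close>
  have same: "expectation (\<lambda>\<omega>. (u \<bullet> b t \<omega>) * (a \<bullet> b t \<omega>)) = t * (u \<bullet> (W *v a))" if t: "t \<ge> 0" for t u a
  proof -
    have "t * ((u + a) \<bullet> (W *v (u + a))) = expectation (\<lambda>\<omega>. ((u + a) \<bullet> b t \<omega>)\<^sup>2)"
      by (rule var[OF t, symmetric])
    also have "\<dots> = expectation (\<lambda>\<omega>. (u \<bullet> b t \<omega>)\<^sup>2 + (a \<bullet> b t \<omega>)\<^sup>2 + 2 * ((u \<bullet> b t \<omega>) * (a \<bullet> b t \<omega>)))"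
      by (intro Bochner_Integration.integral_cong refl) (simp add: inner_add_left power2_sum)
    also have "\<dots> = t * (u \<bullet> (W *v u)) + t * (a \<bullet> (W *v a))
        + 2 * expectation (\<lambda>\<omega>. (u \<bullet> b t \<omega>) * (a \<bullet> b t \<omega>))"
      using sq[OF t] prod[OF t t] by (simp add: var[OF t])
    finally have *: "t * ((u + a) \<bullet> (W *v (u + a))) = \<dots>" .
    have "a \<bullet> (W *v u) = u \<bullet> (W *v a)"
      using inner_matrix_vector_mult_transpose[of a W u] by (simp add: sym inner_commute)
    then have "(u + a) \<bullet> (W *v (u + a)) = u \<bullet> (W *v u) + a \<bullet> (W *v a) + 2 * (u \<bullet> (W *v a))"
      by (simp add: matrix_vector_right_distrib inner_add_left inner_add_right)
    with * show ?thesis by (simp add: distrib_left)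
  qed
  have le: "expectation (\<lambda>\<omega>. (u \<bullet> b s \<omega>) * (a \<bullet> b t \<omega>)) = s * (u \<bullet> (W *v a))"
    if s: "0 \<le> s" and st: "s \<le> t" for s t u a
  proof -
    \<comment> \<open>Independence is formulated along infinite time sequences. Remaining at t from
      index 2 on makes the first two increments those over [0, s] and [s, t].\<close>
    define \<tau> :: "nat \<Rightarrow> real" where "\<tau> i = (if i = 0 then 0 else if i = 1 then s else t)" for i
    have inc: "incseq \<tau>"
      using s st by (intro incseq_SucI) (simp add: \<tau>_def)
    have "0 \<le> \<tau> 0"
      by (simp add: \<tau>_def)
    from indep[OF this inc]
    have "indep_vars (\<lambda>_. borel) (\<lambda>i \<omega>. b (\<tau> (Suc i)) \<omega> - b (\<tau> i) \<omega>) UNIV" .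
    from indep_var_restrict[OF this, of "{0}" "{1}"]
    have "indep_var (PiM {0} (\<lambda>_. borel)) (\<lambda>\<omega>. \<lambda>i\<in>{0}. b (\<tau> (Suc i)) \<omega> - b (\<tau> i) \<omega>)
        (PiM {1} (\<lambda>_. borel)) (\<lambda>\<omega>. \<lambda>i\<in>{1}. b (\<tau> (Suc i)) \<omega> - b (\<tau> i) \<omega>)"
      by simp
    from indep_var_compose[OF this, of "\<lambda>f. u \<bullet> f 0" borel "\<lambda>f. a \<bullet> f 1" borel]
    have "indep_var borel (\<lambda>\<omega>. u \<bullet> (b s \<omega> - b 0 \<omega>)) borel (\<lambda>\<omega>. a \<bullet> (b t \<omega> - b s \<omega>))"
      by (simp add: \<tau>_def o_def)
    then have "expectation (\<lambda>\<omega>. (u \<bullet> (b s \<omega> - b 0 \<omega>)) * (a \<bullet> (b t \<omega> - b s \<omega>))) = 0"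
      using incr[OF s st, of a] incr[OF order_refl s, of u]
      by (subst indep_var_lebesgue_integral) (simp_all add: o_def)
    also have "expectation (\<lambda>\<omega>. (u \<bullet> (b s \<omega> - b 0 \<omega>)) * (a \<bullet> (b t \<omega> - b s \<omega>)))
        = expectation (\<lambda>\<omega>. (u \<bullet> b s \<omega>) * (a \<bullet> b t \<omega>) - (u \<bullet> b s \<omega>) * (a \<bullet> b s \<omega>))"
      by (intro Bochner_Integration.integral_cong refl) (simp add: b0 inner_diff_right right_diff_distrib)
    also have "\<dots> = expectation (\<lambda>\<omega>. (u \<bullet> b s \<omega>) * (a \<bullet> b t \<omega>)) - s * (u \<bullet> (W *v a))"
      using prod s st by (simp add: same)
    finally show ?thesis by simp
  qed
  have "expectation (\<lambda>\<omega>. (u \<bullet> b s \<omega>) * (a \<bullet> b t \<omega>)) = min s t * (u \<bullet> (W *v a))"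
    if "s \<ge> 0" "t \<ge> 0" for s t u a
  proof (cases "s \<le> t")
    case True
    then show ?thesis using le[OF that(1)] by simp
  next
    case False
    have "a \<bullet> (W *v u) = u \<bullet> (W *v a)"
      using inner_matrix_vector_mult_transpose[of a W u] by (simp add: sym inner_commute)
    then show ?thesis
      using False le[OF that(2), of s a u] by (simp add: mult.commute[of "u \<bullet> _"])
  qed
  with meas paths sq show "brownian_second_moments M W b"
    by (simp add: brownian_second_moments_def)
  show "integrable M (\<lambda>\<omega>. u \<bullet> b t \<omega>)" "expectation (\<lambda>\<omega>. u \<bullet> b t \<omega>) = 0" if "t \<ge> 0" for t u
    using int mean that by auto
qed

text \<open>Carries independence of the two whole processes over to scalar functions of their values
  at single times.\<close>

lemma process_events_vimage:
  assumes "t \<ge> 0" and b: "b t \<in> borel_measurable M" and f: "f \<in> borel_measurable borel"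
  shows "sigma_sets (space M) {(\<lambda>\<omega>. f (b t \<omega>)) -` A \<inter> space M | A. A \<in> sets borel} \<subseteq> process_events M b"
  unfolding process_events_def
proof (rule sigma_sets_mono)
  show "{(\<lambda>\<omega>. f (b t \<omega>)) -` A \<inter> space M | A. A \<in> sets borel}
      \<subseteq> sigma_sets (space M) (\<Union>t\<in>{0..}. {b t -` B \<inter> space M | B. B \<in> sets borel})"
  proof safe
    fix A :: "'c set" assume "A \<in> sets borel"
    then have "f -` A \<in> sets borel"
      using measurable_sets[OF f, of A] by simp
    moreover have "(\<lambda>\<omega>. f (b t \<omega>)) -` A \<inter> space M = b t -` (f -` A) \<inter> space M"
      by auto
    ultimately show "(\<lambda>\<omega>. f (b t \<omega>)) -` A \<inter> space M
        \<in> sigma_sets (space M) (\<Union>t\<in>{0..}. {b t -` B \<inter> space M | B. B \<in> sets borel})"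
      using assms(1) by (intro sigma_sets.Basic) auto
  qed
qed

lemma indep_processes_uncorrelated:
  fixes W1 :: "real^'n::finite^'n" and W2 :: "real^'m::finite^'m"
  assumes w: "brownian_motion M W1 w" "posdef W1" and v: "brownian_motion M W2 v" "posdef W2"
    and ind: "indep_set (process_events M w) (process_events M v)" and st: "s \<ge> 0" "t \<ge> 0"
  shows "expectation (\<lambda>\<omega>. (u \<bullet> w s \<omega>) * (a \<bullet> v t \<omega>)) = 0"
proof -
  note W = brownian_motion_second_moments[OF w] and V = brownian_motion_second_moments[OF v]
  have m: "w s \<in> borel_measurable M" "v t \<in> borel_measurable M"
    using W(1) V(1) st by (auto simp: brownian_second_moments_def)
  have "indep_var borel (\<lambda>\<omega>. u \<bullet> w s \<omega>) borel (\<lambda>\<omega>. a \<bullet> v t \<omega>)"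
    unfolding indep_var_eq
  proof (intro conjI)
    show "random_variable borel (\<lambda>\<omega>. u \<bullet> w s \<omega>)" "random_variable borel (\<lambda>\<omega>. a \<bullet> v t \<omega>)"
      using m by simp_all
    have "sigma_sets (space M) {(\<lambda>\<omega>. u \<bullet> w s \<omega>) -` A \<inter> space M | A. A \<in> sets borel} \<subseteq> process_events M w"
      "sigma_sets (space M) {(\<lambda>\<omega>. a \<bullet> v t \<omega>) -` A \<inter> space M | A. A \<in> sets borel} \<subseteq> process_events M v"
      using process_events_vimage[where b=w and t=s and f="\<lambda>x. u \<bullet> x"]
        process_events_vimage[where b=v and t=t and f="\<lambda>x. a \<bullet> x"] m st by simp_all
    then show "indep_set (sigma_sets (space M) {(\<lambda>\<omega>. u \<bullet> w s \<omega>) -` A \<inter> space M | A. A \<in> sets borel})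
        (sigma_sets (space M) {(\<lambda>\<omega>. a \<bullet> v t \<omega>) -` A \<inter> space M | A. A \<in> sets borel})"
      using ind unfolding indep_set_def by (elim indep_sets_mono_sets) (auto split: bool.split)
  qed
  from indep_var_lebesgue_integral[OF this W(2)[OF st(1)] V(2)[OF st(2)]]
  show ?thesis by (simp add: W(3) st)
qed

end

section \<open>Joint vectors of system and filter\<close>

definition join_vec :: "'a^'n \<Rightarrow> 'a^'m \<Rightarrow> 'a^('n + 'm)" where
  "join_vec x y = (\<chi> i. case i of Inl j \<Rightarrow> x $ j | Inr j \<Rightarrow> y $ j)"

lemma join_vec_nth [simp]: "join_vec x y $ Inl i = x $ i" "join_vec x y $ Inr j = y $ j"
  by (simp_all add: join_vec_def)

lemma sum_UNIV_Plus:
  fixes f :: "'n::finite + 'm::finite \<Rightarrow> 'a::comm_monoid_add"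
  shows "(\<Sum>i\<in>UNIV. f i) = (\<Sum>i\<in>UNIV. f (Inl i)) + (\<Sum>i\<in>UNIV. f (Inr i))"
  using sum.Plus[of "UNIV :: 'n set" "UNIV :: 'm set" f] by simp

lemma inner_join_vec:
  fixes x a :: "real^'n::finite" and y c :: "real^'m::finite"
  shows "join_vec x y \<bullet> join_vec a c = x \<bullet> a + y \<bullet> c"
  by (simp add: inner_vec_def sum_UNIV_Plus)

lemma join_vec_cases:
  obtains x y where "u = join_vec x y"
proof
  show "u = join_vec (\<chi> i. u $ Inl i) (\<chi> i. u $ Inr i)"
    by (simp add: vec_eq_iff split_sum_all)
qed

lemma block_matrix_mult_join_vec:
  fixes P :: "real^'n1::finite^'m1::finite" and S :: "real^'n2::finite^'m2::finite"
  shows "block_matrix P Q R S *v join_vec x y = join_vec (P *v x + Q *v y) (R *v x + S *v y)"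
  by (simp add: vec_eq_iff split_sum_all matrix_vector_mult_def block_matrix_def sum_UNIV_Plus)

lemma bounded_linear_join_vec:
  "bounded_linear (\<lambda>p. join_vec (fst p) (snd p) :: real^('n::finite + 'm::finite))"
  by (intro linear_conv_bounded_linear[THEN iffD1] linearI)
    (simp_all add: vec_eq_iff split_sum_all)

lemma continuous_on_join_vec [continuous_intros]:
  fixes f :: "'a::topological_space \<Rightarrow> real^'n::finite" and g :: "'a \<Rightarrow> real^'m::finite"
  assumes "continuous_on T f" "continuous_on T g"
  shows "continuous_on T (\<lambda>t. join_vec (f t) (g t))"
  using bounded_linear.continuous_on[OF bounded_linear_join_vec continuous_on_Pair[OF assms]] by simp

lemma has_integral_join_vec:
  fixes f :: "real \<Rightarrow> real^'n::finite" and g :: "real \<Rightarrow> real^'m::finite"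
  assumes "(f has_integral i) T" "(g has_integral j) T"
  shows "((\<lambda>t. join_vec (f t) (g t)) has_integral join_vec i j) T"
proof -
  have l: "bounded_linear (\<lambda>x. join_vec x (0 :: real^'m) :: real^('n + 'm))"
    "bounded_linear (\<lambda>y. join_vec (0 :: real^'n) y :: real^('n + 'm))"
    using bounded_linear_compose[OF bounded_linear_join_vec, of "\<lambda>x. (x, 0)"]
      bounded_linear_compose[OF bounded_linear_join_vec, of "\<lambda>y. (0, y)"]
      bounded_linear_Pair[OF bounded_linear_ident bounded_linear_zero]
      bounded_linear_Pair[OF bounded_linear_zero bounded_linear_ident] by simp_all
  have split: "join_vec x y = join_vec x 0 + join_vec 0 y" for x :: "real^'n" and y :: "real^'m"
    by (simp add: vec_eq_iff split_sum_all)
  show ?thesis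
    using has_integral_add[OF has_integral_linear[OF assms(1) l(1)] has_integral_linear[OF assms(2) l(2)]]
    by (simp add: o_def flip: split)
qed

section \<open>The loss as a trace\<close>

text \<open>Justifies the \<open>THE\<close> in \<open>linear_response\<close>: variation of
  constants determines the solution at nonnegative times, and the prescribed zeros determine it at
  negative ones.\<close>

lemma linear_response_solves:
  fixes F :: "real^'n::finite^'n"
  assumes b: "continuous_on {0..} b"
  shows "continuous_on {0..} (linear_response F b)"
    and "\<And>t. t \<ge> 0 \<Longrightarrow> linear_response F b t = integral {0..t} (\<lambda>s. F *v linear_response F b s) + b t"
proof -
  obtain \<Phi> where \<Phi>: "fundamental_matrix F \<Phi>"
    using fundamental_matrix_exists by blast
  define \<eta> where "\<eta> = (\<lambda>t. \<Phi> t *v integral {0..t} (\<lambda>s. \<Phi> (- s) *v (F *v b s)))"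
  have \<eta>: "continuous_on {0..} \<eta>"
    "\<And>t. t \<ge> 0 \<Longrightarrow> integral {0..t} (\<lambda>s. F *v (b s + \<eta> s)) = \<eta> t"
    unfolding \<eta>_def by (rule linear_response_exists[OF \<Phi> b]; assumption)+
  define \<xi> where "\<xi> t = (if t < 0 then 0 else b t + \<eta> t)" for t
  define P where "P \<xi> \<longleftrightarrow> continuous_on {0..} \<xi> \<and> (\<forall>t<0. \<xi> t = 0) \<and>
     (\<forall>t\<ge>0. \<xi> t = integral {0..t} (\<lambda>s. F *v \<xi> s) + b t)" for \<xi>
  have "P \<xi>"
    unfolding P_def
  proof (intro conjI allI impI)
    show "continuous_on {0..} \<xi>"
      using continuous_on_add[OF b \<eta>(1)] by (rule continuous_on_eq) (auto simp: \<xi>_def)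
    fix t :: real assume t: "t \<ge> 0"
    have "integral {0..t} (\<lambda>s. F *v \<xi> s) = integral {0..t} (\<lambda>s. F *v (b s + \<eta> s))"
      by (rule Henstock_Kurzweil_Integration.integral_cong) (simp add: \<xi>_def)
    with \<eta>(2)[OF t] t show "\<xi> t = integral {0..t} (\<lambda>s. F *v \<xi> s) + b t"
      by (simp add: \<xi>_def)
  qed (simp add: \<xi>_def)
  moreover have "\<zeta> = \<xi>" if \<zeta>: "P \<zeta>" for \<zeta>
  proof
    fix t
    show "\<zeta> t = \<xi> t"
    proof (cases "t < 0")
      case True
      then show ?thesis using \<zeta> \<open>P \<xi>\<close> by (simp add: P_def)
    next
      case False
      have "\<And>t. t \<ge> 0 \<Longrightarrow> \<zeta> t = integral {0..t} (\<lambda>s. F *v \<zeta> s) + b t" "continuous_on {0..} \<zeta>"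
        using \<zeta> unfolding P_def by blast+
      from linear_response_unique[OF \<Phi> b this(2,1)] False show ?thesis
        by (simp add: \<xi>_def \<eta>_def)
    qed
  qed
  ultimately have "P (linear_response F b)"
    unfolding linear_response_def P_def[symmetric] by (metis theI)
  then show "continuous_on {0..} (linear_response F b)"
    and "\<And>t. t \<ge> 0 \<Longrightarrow> linear_response F b t = integral {0..t} (\<lambda>s. F *v linear_response F b s) + b t"
    unfolding P_def by blast+
qed

text \<open>Testing B v with y is testing v with B^T y, which produces the block B W2 B^T;
  independence removes the cross terms.\<close>

lemma (in prob_space) brownian_second_moments_join_vec:
  fixes w :: "real \<Rightarrow> 'a \<Rightarrow> real^'n::finite" and v :: "real \<Rightarrow> 'a \<Rightarrow> real^'m::finite"
    and B :: "real^'m^'k::finite"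
  assumes w: "brownian_motion M W1 w" "posdef W1" and v: "brownian_motion M W2 v" "posdef W2"
    and ind: "indep_set (process_events M w) (process_events M v)"
  shows "brownian_second_moments M (block_matrix W1 0 0 (B ** W2 ** transpose B))
    (\<lambda>t \<omega>. join_vec (w t \<omega>) (B *v v t \<omega>))"
proof -
  note W = brownian_motion_second_moments(1)[OF w, unfolded brownian_second_moments_def]
  note V = brownian_motion_second_moments(1)[OF v, unfolded brownian_second_moments_def]
  let ?b = "\<lambda>t \<omega>. join_vec (w t \<omega>) (B *v v t \<omega>)"
  have wm: "t \<ge> 0 \<Longrightarrow> w t \<in> borel_measurable M" and vm: "t \<ge> 0 \<Longrightarrow> v t \<in> borel_measurable M" for t
    using W V by auto
  have bm: "?b t \<in> borel_measurable M" if "t \<ge> 0" for t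
  proof -
    have "(\<lambda>\<omega>. (w t \<omega>, B *v v t \<omega>)) \<in> borel_measurable M"
      using wm[OF that] measurable_compose[OF vm[OF that]
          borel_measurable_continuous_onI[OF linear_continuous_on[OF matrix_vector_mul_bounded_linear]]]
      by (rule borel_measurable_Pair)
    from measurable_compose[OF this borel_measurable_continuous_onI[OF
          linear_continuous_on[OF bounded_linear_join_vec]]]
    show ?thesis by simp
  qed
  have cb: "continuous_on {0..} (\<lambda>t. ?b t \<omega>)" if "\<omega> \<in> space M" for \<omega>
    using W V that by (intro continuous_intros) auto
  have inner: "join_vec x y \<bullet> ?b t \<omega> = x \<bullet> w t \<omega> + (transpose B *v y) \<bullet> v t \<omega>" for x y t \<omega>
    by (simp add: inner_join_vec inner_matrix_vector_mult_transpose del: transpose_matrix_vector)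
  have wi: "(\<lambda>\<omega>. x \<bullet> w t \<omega>) \<in> borel_measurable M" and vi: "(\<lambda>\<omega>. y \<bullet> v t \<omega>) \<in> borel_measurable M"
    if "t \<ge> 0" for x y t
    using wm[OF that] vm[OF that] by simp_all
  have wsq: "integrable M (\<lambda>\<omega>. (x \<bullet> w t \<omega>)\<^sup>2)" and vsq: "integrable M (\<lambda>\<omega>. (y \<bullet> v t \<omega>)\<^sup>2)"
    if "t \<ge> 0" for x y t
    using W V that by auto
  have prods: "integrable M (\<lambda>\<omega>. (x \<bullet> w s \<omega>) * (x' \<bullet> w t \<omega>))"
    "integrable M (\<lambda>\<omega>. (y \<bullet> v s \<omega>) * (y' \<bullet> v t \<omega>))"
    "integrable M (\<lambda>\<omega>. (x \<bullet> w s \<omega>) * (y' \<bullet> v t \<omega>))"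
    "integrable M (\<lambda>\<omega>. (y \<bullet> v s \<omega>) * (x' \<bullet> w t \<omega>))"
    if "s \<ge> 0" "t \<ge> 0" for x x' y y' s t
    using that by (auto intro!: integrable_mult_of_squares wi vi wsq vsq)
  have sq: "integrable M (\<lambda>\<omega>. (u \<bullet> ?b t \<omega>)\<^sup>2)" if "t \<ge> 0" for t u
  proof -
    obtain x y where u: "u = join_vec x y" by (rule join_vec_cases)
    show ?thesis
      unfolding u inner power2_eq_square distrib_left distrib_right
      using that by (intro Bochner_Integration.integrable_add prods)
  qed
  have cross: "expectation (\<lambda>\<omega>. (y \<bullet> v s \<omega>) * (x \<bullet> w t \<omega>)) = 0"
    "expectation (\<lambda>\<omega>. (x \<bullet> w t \<omega>) * (y \<bullet> v s \<omega>)) = 0" if "s \<ge> 0" "t \<ge> 0" for x y s t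
    using indep_processes_uncorrelated[OF w v ind that(2,1), of x y] by (simp_all add: mult.commute)
  have cov: "expectation (\<lambda>\<omega>. (u \<bullet> ?b s \<omega>) * (a \<bullet> ?b t \<omega>))
      = min s t * (u \<bullet> (block_matrix W1 0 0 (B ** W2 ** transpose B) *v a))"
    if st: "s \<ge> 0" "t \<ge> 0" for s t u a
  proof -
    obtain x y where u: "u = join_vec x y" by (rule join_vec_cases)
    obtain x' y' where a: "a = join_vec x' y'" by (rule join_vec_cases)
    let ?y = "transpose B *v y" and ?y' = "transpose B *v y'"
    have "expectation (\<lambda>\<omega>. (u \<bullet> ?b s \<omega>) * (a \<bullet> ?b t \<omega>))
        = expectation (\<lambda>\<omega>. (x \<bullet> w s \<omega>) * (x' \<bullet> w t \<omega>)) + expectation (\<lambda>\<omega>. (?y \<bullet> v s \<omega>) * (?y' \<bullet> v t \<omega>))"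
      unfolding u a inner distrib_left distrib_right
      using prods[OF st] cross[OF st] cross[OF st(2,1)] by simp
    also have "\<dots> = min s t * (x \<bullet> (W1 *v x') + ?y \<bullet> (W2 *v ?y'))"
      using W V st by (simp add: distrib_left)
    also have "?y \<bullet> (W2 *v ?y') = y \<bullet> ((B ** W2 ** transpose B) *v y')"
      using inner_matrix_vector_mult_transpose[of y B "W2 *v ?y'"]
      by (simp add: matrix_vector_mul_assoc matrix_mul_assoc del: transpose_matrix_vector)
    finally show ?thesis
      by (simp add: u a block_matrix_mult_join_vec inner_join_vec)
  qed
  show ?thesis
    unfolding brownian_second_moments_def using bm cb sq cov by blast
qed

text \<open>The vectors c i are the rows of [G, -CK]. Each component of the output error is c i .
  \<xi>, so the squared norm is a finite sum of scalar second moments and its limit is the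
  trace.\<close>

lemma oe_loss_eq_trace:
  fixes I :: "('n::finite, 'm::finite, 'p::finite) oe_instance"
  assumes noise: "oe_noise I M w v" and pos: "posdef (covW1 I)" "posdef (covW2 I)"
    and D: "lyapunov_form D (A_cl I (AK, BK, CK))"
    and S: "A_cl I (AK, BK, CK) ** S + S ** transpose (A_cl I (AK, BK, CK)) + W_cl I (AK, BK, CK) = 0"
  defines "c \<equiv> \<lambda>i. join_vec (sysG I $ i) (- (CK $ i))"
  shows "oe_loss I M w v (AK, BK, CK) = (\<Sum>i\<in>UNIV. c i \<bullet> (S *v c i))"
proof -
  interpret prob_space M using noise by (simp add: oe_noise_def)
  have w: "brownian_motion M (covW1 I) w" and v: "brownian_motion M (covW2 I) v"
    and ind: "indep_set (process_events M w) (process_events M v)"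
    using noise by (simp_all add: oe_noise_def)
  let ?K = "(AK, BK, CK)"
  let ?x = "oe_state I w" and ?z = "filter_state I w v ?K"
  define b where "b t \<omega> = join_vec (w t \<omega>) (BK *v v t \<omega>)" for t \<omega>
  define \<xi> where "\<xi> t \<omega> = join_vec (?x t \<omega>) (?z t \<omega>)" for t \<omega>
  have b: "brownian_second_moments M (W_cl I ?K) b"
    using brownian_second_moments_join_vec[OF w pos(1) v pos(2) ind, of BK]
    by (simp add: W_cl_def b_def[abs_def])
  have "continuous_on {0..} (\<lambda>t. \<xi> t \<omega>) \<and>
      (\<forall>t\<ge>0. \<xi> t \<omega> = integral {0..t} (\<lambda>s. A_cl I ?K *v \<xi> s \<omega>) + b t \<omega>)"
    if \<omega>: "\<omega> \<in> space M" for \<omega>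
  proof -
    have cw: "continuous_on {0..} (\<lambda>t. w t \<omega>)" and cv: "continuous_on {0..} (\<lambda>t. v t \<omega>)"
      using w v \<omega> by (auto simp: brownian_motion_def)
    have x: "continuous_on {0..} (\<lambda>t. ?x t \<omega>)"
      "\<And>t. t \<ge> 0 \<Longrightarrow> ?x t \<omega> = integral {0..t} (\<lambda>s. sysA I *v ?x s \<omega>) + w t \<omega>"
      using linear_response_solves[OF cw, where F="sysA I"] by (simp_all add: oe_state_def)
    have ix: "(\<lambda>s. X *v ?x s \<omega>) integrable_on {0..t}" for X :: "real^'n^'k::finite" and t
      by (intro integrable_continuous_real continuous_intros continuous_on_subset[OF x(1)]) auto
    let ?y = "\<lambda>t. integrated_output I w v t \<omega>"
    have "continuous_on {0..} (\<lambda>t. integral {0..t} (\<lambda>s. sysC I *v ?x s \<omega>))"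
      unfolding continuous_on_eq_continuous_within
    proof
      fix t :: real assume t: "t \<in> {0..}"
      have "at t within {0..} = at t within {0..t + 1}"
        by (rule at_within_nhd[of t "{..<t + 1}"]) auto
      moreover have "continuous_on {0..t + 1} (\<lambda>t. integral {0..t} (\<lambda>s. sysC I *v ?x s \<omega>))"
        by (rule indefinite_integral_continuous_1[OF ix])
      then have "continuous (at t within {0..t + 1}) (\<lambda>t. integral {0..t} (\<lambda>s. sysC I *v ?x s \<omega>))"
        using t by (auto simp: continuous_on_eq_continuous_within)
      ultimately show "continuous (at t within {0..}) (\<lambda>t. integral {0..t} (\<lambda>s. sysC I *v ?x s \<omega>))"
        by simp
    qed
    then have cy: "continuous_on {0..} (\<lambda>t. BK *v ?y t)"
      unfolding integrated_output_def by (intro continuous_intros cv)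
    have z: "continuous_on {0..} (\<lambda>t. ?z t \<omega>)"
      "\<And>t. t \<ge> 0 \<Longrightarrow> ?z t \<omega> = integral {0..t} (\<lambda>s. AK *v ?z s \<omega>) + BK *v ?y t"
      using linear_response_solves[OF cy, where F=AK] by (simp_all add: filter_state_def)
    have iz: "(\<lambda>s. AK *v ?z s \<omega>) integrable_on {0..t}" for t
      by (intro integrable_continuous_real continuous_intros continuous_on_subset[OF z(1)]) auto
    have "\<xi> t \<omega> = integral {0..t} (\<lambda>s. A_cl I ?K *v \<xi> s \<omega>) + b t \<omega>" if t: "t \<ge> 0" for t
    proof -
      \<comment> \<open>Moving \<open>BK\<close> inside the integral merges the cascade of system
        and filter into one linear equation with matrix \<open>A_cl\<close> and noise (w, BK
        v).\<close>
      have "BK *v integral {0..t} (\<lambda>s. sysC I *v ?x s \<omega>) = integral {0..t} (\<lambda>s. (BK ** sysC I) *v ?x s \<omega>)"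
        using integral_linear[OF ix[of "sysC I" t] matrix_vector_mul_bounded_linear[of BK]]
        by (simp add: o_def matrix_vector_mul_assoc)
      then have "?z t \<omega> = integral {0..t} (\<lambda>s. (BK ** sysC I) *v ?x s \<omega>)
          + integral {0..t} (\<lambda>s. AK *v ?z s \<omega>) + BK *v v t \<omega>"
        using z(2)[OF t] by (simp add: integrated_output_def matrix_vector_right_distrib)
      moreover have "((\<lambda>s. A_cl I ?K *v \<xi> s \<omega>) has_integral
          join_vec (integral {0..t} (\<lambda>s. sysA I *v ?x s \<omega>))
            (integral {0..t} (\<lambda>s. (BK ** sysC I) *v ?x s \<omega>) + integral {0..t} (\<lambda>s. AK *v ?z s \<omega>))) {0..t}"
        unfolding A_cl_def \<xi>_def prod.case block_matrix_mult_join_vec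
        using has_integral_join_vec[OF integrable_integral[OF ix]
            has_integral_add[OF integrable_integral[OF ix] integrable_integral[OF iz]]]
        by simp
      ultimately show ?thesis
        using x(2)[OF t]
        by (simp add: integral_unique) (simp add: \<xi>_def b_def vec_eq_iff split_sum_all)
    qed
    with x(1) z(1) show ?thesis
      unfolding \<xi>_def by (simp add: continuous_on_join_vec)
  qed
  then have \<xi>: "\<And>\<omega>. \<omega> \<in> space M \<Longrightarrow> continuous_on {0..} (\<lambda>t. \<xi> t \<omega>)"
    and eq: "\<And>\<omega> t. \<omega> \<in> space M \<Longrightarrow> t \<ge> 0 \<Longrightarrow> \<xi> t \<omega> = integral {0..t} (\<lambda>s. A_cl I ?K *v \<xi> s \<omega>) + b t \<omega>"
    by blast+
  obtain \<Phi> where \<Phi>: "fundamental_matrix (A_cl I ?K) \<Phi>"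
    using fundamental_matrix_exists by blast
  have "((\<lambda>t. \<Sum>i\<in>UNIV. expectation (\<lambda>\<omega>. (c i \<bullet> \<xi> t \<omega>)\<^sup>2)) \<longlongrightarrow> (\<Sum>i\<in>UNIV. c i \<bullet> (S *v c i))) at_top"
    by (intro tendsto_sum response_second_moment_tendsto[OF D b S \<xi> eq])
  moreover have "\<forall>\<^sub>F t in at_top. (\<Sum>i\<in>UNIV. expectation (\<lambda>\<omega>. (c i \<bullet> \<xi> t \<omega>)\<^sup>2))
      = expectation (\<lambda>\<omega>. (norm (sysG I *v ?x t \<omega> - CK *v ?z t \<omega>))\<^sup>2)"
    using eventually_ge_at_top[of 0]
  proof eventually_elim
    case (elim t)
    have int: "integrable M (\<lambda>\<omega>. (c i \<bullet> \<xi> t \<omega>)\<^sup>2)" for i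
      by (rule response_second_moment(1)[OF \<Phi> b elim S \<xi> eq])
    have "(norm (sysG I *v ?x t \<omega> - CK *v ?z t \<omega>))\<^sup>2 = (\<Sum>i\<in>UNIV. (c i \<bullet> \<xi> t \<omega>)\<^sup>2)" for \<omega>
    proof -
      have "(sysG I *v ?x t \<omega> - CK *v ?z t \<omega>) $ i = c i \<bullet> \<xi> t \<omega>" for i
        by (simp add: c_def \<xi>_def inner_join_vec matrix_mult_dot)
      moreover have "(norm z)\<^sup>2 = (\<Sum>i\<in>UNIV. (z $ i)\<^sup>2)" for z :: "real^'p"
        by (simp add: norm_vec_def L2_set_def sum_nonneg)
      ultimately show ?thesis
        by (simp only:)
    qed
    then show ?case
      using int by simp
  qed
  ultimately have "((\<lambda>t. expectation (\<lambda>\<omega>. (norm (sysG I *v ?x t \<omega> - CK *v ?z t \<omega>))\<^sup>2))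
      \<longlongrightarrow> (\<Sum>i\<in>UNIV. c i \<bullet> (S *v c i))) at_top"
    by (rule Lim_transform_eventually)
  then show ?thesis
    unfolding oe_loss_def snd_conv by (intro tendsto_Lim) auto
qed

section \<open>The instance\<close>

text \<open>Caratheodory's form of differentiability: Cauchy-Schwarz bounds the difference quotient
  by the norm of G y, so continuity of G at x replaces any differentiation.\<close>

lemma GDERIV_zeroI:
  fixes f :: "'a::real_inner \<Rightarrow> real"
  assumes f: "\<forall>\<^sub>F y in nhds x. f y - f x = (y - x) \<bullet> G y" and G: "(G \<longlongrightarrow> 0) (nhds x)"
  shows "GDERIV f x :> 0"
proof -
  have "((\<lambda>y. norm (f y - f x) / norm (y - x)) \<longlongrightarrow> 0) (at x)"
  proof (rule tendsto_sandwich[OF _ _ tendsto_const])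
    show "((\<lambda>y. norm (G y)) \<longlongrightarrow> 0) (at x)"
      using tendsto_mono[OF at_within_le_nhds G] by (rule tendsto_norm_zero)
    have "\<forall>\<^sub>F y in at x. f y - f x = (y - x) \<bullet> G y"
      by (rule filter_leD[OF at_within_le_nhds f])
    moreover have "\<forall>\<^sub>F y in at x. y \<noteq> x"
      by (simp add: eventually_at_filter)
    ultimately show "\<forall>\<^sub>F y in at x. norm (f y - f x) / norm (y - x) \<le> norm (G y)"
    proof eventually_elim
      case (elim y)
      have "norm (f y - f x) \<le> norm (y - x) * norm (G y)"
        unfolding elim(1) real_norm_def by (rule Cauchy_Schwarz_ineq2)
      with elim(2) show ?case by (simp add: field_simps)
    qed
  qed simp
  then show ?thesis
    by (simp add: gderiv_def has_derivative_iff_norm)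
qed

lemma tendsto_block_matrix:
  fixes P :: "'a \<Rightarrow> 'b::topological_space^'n1::finite^'m1::finite" and S :: "'a \<Rightarrow> 'b^'n2::finite^'m2::finite"
  assumes "(P \<longlongrightarrow> P0) L" "(Q \<longlongrightarrow> Q0) L" "(R \<longlongrightarrow> R0) L" "(S \<longlongrightarrow> S0) L"
  shows "((\<lambda>x. block_matrix (P x) (Q x) (R x) (S x)) \<longlongrightarrow> block_matrix P0 Q0 R0 S0) L"
proof (intro vec_tendstoI)
  fix i j
  show "((\<lambda>x. block_matrix (P x) (Q x) (R x) (S x) $ i $ j) \<longlongrightarrow> block_matrix P0 Q0 R0 S0 $ i $ j) L"
    using assms by (cases i; cases j) (simp_all add: block_matrix_def tendsto_vec_nth)
qed

lemma tendsto_A_cl: "((\<lambda>K. A_cl I K) \<longlongrightarrow> A_cl I K0) (nhds K0)"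
  unfolding A_cl_def case_prod_beta'
  by (intro tendsto_block_matrix bounded_bilinear.tendsto[OF bounded_bilinear_matrix_matrix_mult]
      tendsto_intros filterlim_ident)

lemma tendsto_W_cl: "((\<lambda>K. W_cl I K) \<longlongrightarrow> W_cl I K0) (nhds K0)"
  unfolding W_cl_def case_prod_beta'
  by (intro tendsto_block_matrix bounded_bilinear.tendsto[OF bounded_bilinear_matrix_matrix_mult]
      bounded_linear.tendsto[OF bounded_linear_transpose] tendsto_intros filterlim_ident)

lemma Sigma_cov_eq:
  assumes D: "lyapunov_form D (A_cl I K)"
  shows "A_cl I K ** Sigma_cov I K + Sigma_cov I K ** transpose (A_cl I K) + W_cl I K = 0"
    and "A_cl I K ** S + S ** transpose (A_cl I K) + W_cl I K = 0 \<Longrightarrow> Sigma_cov I K = S"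
  unfolding Sigma_cov_def
  using theI'[OF lyapunov_equation_unique_solution[OF D]]
    the1_equality[OF lyapunov_equation_unique_solution[OF D]] by blast+

section \<open>Assumptions (S1) to (S4) and the optimal filters of the instance\<close>

lemma map_matrix_mat_mult:
  "map_matrix complex_of_real (r *\<^sub>R mat 1) *v z = complex_of_real r *s z" for z :: "complex^'n::finite"
  by (simp add: vec_eq_iff matrix_vector_mult_def map_matrix_def mat_def if_distrib if_distribR cong: if_cong)

lemma hurwitz_scaled_identity: "r < 0 \<Longrightarrow> hurwitz (r *\<^sub>R mat 1 :: real^'n::finite^'n)"
  by (auto simp: hurwitz_def complex_eigenvalue_def map_matrix_mat_mult)

text \<open>Covers both Gramians: \<open>sysA I_bad\<close> and the drift of every optimal filter
  are multiples of the identity.\<close>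

lemma matrix_exp_scaled_identity:
  "matrix_exp (s *\<^sub>R mat 1 :: real^'n::finite^'n) = exp s *\<^sub>R mat 1"
proof -
  have p: "((**) (s *\<^sub>R mat 1 :: real^'n^'n) ^^ k) (mat 1) = s ^ k *\<^sub>R mat 1" for k
    by (induction k) (simp_all add: scalar_matrix_assoc[symmetric])
  have "(\<lambda>k. s ^ k /\<^sub>R fact k) sums exp s"
    by (rule exp_converges)
  then have "(\<lambda>k. (s ^ k /\<^sub>R fact k) *\<^sub>R (mat 1 :: real^'n^'n)) sums (exp s *\<^sub>R mat 1)"
    by (rule sums_scaleR_left)
  then show ?thesis
    unfolding matrix_exp_def p by (simp add: sums_iff field_simps)
qed

lemma S1_I_bad: "S1 I_bad"
  using hurwitz_scaled_identity[of "-1", where 'n=2] by (simp add: S1_def I_bad_def)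

lemma has_integral_exp_scaled:
  fixes X :: "'a::euclidean_space"
  assumes "a > 0"
  shows "((\<lambda>s. exp (- (a * s)) *\<^sub>R X) has_integral (1 / a) *\<^sub>R X) {0..}"
  using has_integral_scaleR_left[OF has_integral_exp_minus_to_infinity[OF assms, of 0], of X] by simp

lemma S2_I_bad: "S2 I_bad"
proof -
  have e: "matrix_exp (- (s *\<^sub>R mat 1) :: real^2^2) = exp (- s) *\<^sub>R mat 1" for s
    using matrix_exp_scaled_identity[of "- s"] by simp
  have "((\<lambda>s. exp (- (2 * s)) *\<^sub>R (mat 1 :: real^2^2)) has_integral (1 / 2) *\<^sub>R mat 1) {0..}"
    by (rule has_integral_exp_scaled) simp
  moreover have "transpose (- mat 1 :: real^2^2) = - mat 1"
    by (simp add: vec_eq_iff transpose_def mat_def)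
  ultimately show ?thesis
    unfolding S2_def observable_def
    by (simp add: I_bad_def e scalar_matrix_assoc[symmetric] matrix_scalar_ac exp_add[symmetric] posdef_def
        transpose_scalar scaleR_matrix_vector_assoc[symmetric] has_integral_integrable integral_unique)
qed

lemma S3_I_bad: "S3 I_bad"
  by (simp add: S3_def I_bad_def posdef_def transpose_scalar scaleR_matrix_vector_assoc[symmetric])

lemma transpose_minus_mat: "transpose (- mat 1 :: real^'n::finite^'n) = - mat 1"
  by (simp add: vec_eq_iff transpose_def mat_def)

lemma matrix_inv_right: "invertible A \<Longrightarrow> A ** matrix_inv A = mat 1"
  and matrix_inv_left: "invertible A \<Longrightarrow> matrix_inv A ** A = mat 1"
  unfolding invertible_def matrix_inv_def by (metis (mono_tags, lifting) someI_ex)+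

lemma matrix_inv_mat_1: "matrix_inv (mat 1 :: real^'n::finite^'n) = mat 1"
proof -
  have "invertible (mat 1 :: real^'n^'n)"
    unfolding invertible_def by (rule exI[of _ "mat 1"]) simp
  from matrix_inv_left[OF this] show ?thesis by simp
qed

lemma minus_mat_mult: "- mat 1 ** X = - (X :: real^'n::finite^'m::finite)" "Y ** - mat 1 = - (Y :: real^'n^'m)"
  by (simp_all add: bounded_bilinear.minus_left[OF bounded_bilinear_matrix_matrix_mult]
      bounded_bilinear.minus_right[OF bounded_bilinear_matrix_matrix_mult])

text \<open>The Riccati equation factors as (P + 3 I)(P - I) = 0, and P + 3 I is positive definite
  because P is positive semidefinite.\<close>

lemma P_star_I_bad: "P_star I_bad = mat 1"
  unfolding P_star_def
proof (rule the_equality)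
  have "hurwitz ((-2) *\<^sub>R mat 1 :: real^2^2)"
    by (rule hurwitz_scaled_identity) simp
  moreover have "- mat 1 - mat 1 = ((-2) *\<^sub>R mat 1 :: real^2^2)"
    by (simp add: vec_eq_iff)
  ultimately have "hurwitz (- mat 1 - mat 1 :: real^2^2)"
    by simp
  then show "possemidef (mat 1 :: real^2^2)
     \<and> sysA I_bad ** mat 1 + mat 1 ** transpose (sysA I_bad)
         - mat 1 ** transpose (sysC I_bad) ** matrix_inv (covW2 I_bad) ** sysC I_bad ** mat 1 + covW1 I_bad = 0
     \<and> hurwitz (sysA I_bad - mat 1 ** transpose (sysC I_bad) ** matrix_inv (covW2 I_bad) ** sysC I_bad)"
    by (simp add: I_bad_def possemidef_def matrix_inv_mat_1 transpose_minus_mat minus_mat_mult vec_eq_iff)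
  fix P :: "real^2^2"
  assume P: "possemidef P
     \<and> sysA I_bad ** P + P ** transpose (sysA I_bad)
         - P ** transpose (sysC I_bad) ** matrix_inv (covW2 I_bad) ** sysC I_bad ** P + covW1 I_bad = 0
     \<and> hurwitz (sysA I_bad - P ** transpose (sysC I_bad) ** matrix_inv (covW2 I_bad) ** sysC I_bad)"
  then have "- P - P - P ** P + 3 *\<^sub>R mat 1 = 0"
    by (simp add: I_bad_def matrix_inv_mat_1 transpose_minus_mat minus_mat_mult)
  then have riccati: "P ** P + 2 *\<^sub>R P = 3 *\<^sub>R mat 1"
    by (simp add: vec_eq_iff algebra_simps)
  have "P *v q = mat 1 *v q" for q
  proof -
    \<comment> \<open>The image of q under P - I; it lies in the kernel of P + 3 I and is therefore
      0.\<close>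
    define x where "x = P *v q - q"
    have "(P ** P + 2 *\<^sub>R P) *v q = 3 *\<^sub>R q"
      unfolding riccati by (simp add: scaleR_matrix_vector_assoc[symmetric])
    then have "P *v (P *v q) + 2 *\<^sub>R (P *v q) = 3 *\<^sub>R q"
      by (simp add: matrix_vector_mult_add_rdistrib scaleR_matrix_vector_assoc matrix_vector_mul_assoc)
    moreover have "P *v x + 3 *\<^sub>R x = P *v (P *v q) + 2 *\<^sub>R (P *v q) - 3 *\<^sub>R q"
      by (simp add: x_def matrix_vector_mult_diff_distrib vec_eq_iff)
    ultimately have "P *v x + 3 *\<^sub>R x = 0"
      by simp
    then have "x \<bullet> (P *v x + 3 *\<^sub>R x) = 0"
      by simp
    then have "x \<bullet> (P *v x) + 3 * (x \<bullet> x) = 0"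
      by (simp add: inner_add_right)
    moreover have "x \<bullet> (P *v x) \<ge> 0"
      using P by (simp add: possemidef_def)
    ultimately have "x \<bullet> x \<le> 0" by simp
    then have "x = 0" by (meson inner_gt_zero_iff not_le)
    then show ?thesis by (simp add: x_def)
  qed
  then show "P = mat 1"
    by (simp add: matrix_eq)
qed

text \<open>The optimal drift A - L C = -2 I commutes with every S, so a change of coordinates shows
  only in the input and output matrices.\<close>

lemma K_opt_I_bad:
  "K_opt I_bad = {((-2) *\<^sub>R mat 1, S, matrix_inv S) | S. invertible S}"
proof -
  have L: "L_star I_bad = mat 1"
    by (simp add: L_star_def P_star_I_bad matrix_inv_mat_1) (simp add: I_bad_def matrix_inv_mat_1)
  have A: "sysA I_bad - L_star I_bad ** sysC I_bad = (-2) *\<^sub>R mat 1"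
    unfolding L by (simp add: I_bad_def vec_eq_iff)
  have G: "sysG I_bad = mat 1"
    by (simp add: I_bad_def)
  have "S ** ((-2) *\<^sub>R mat 1) ** matrix_inv S = (-2) *\<^sub>R mat 1" if "invertible S" for S :: "real^2^2"
    by (simp only: matrix_scalar_ac scalar_matrix_assoc[symmetric] matrix_mul_rid matrix_inv_right[OF that])
  then show ?thesis
    unfolding K_opt_def A by (auto simp: L G)
qed

text \<open>Each of the two exponentials contributes exp(-2 s), so the Gramian is S S^T / 4, which
  is positive definite because S is invertible.\<close>

lemma S4_I_bad: "S4 I_bad"
  unfolding S4_def K_opt_I_bad
proof safe
  fix S :: "real^2^2" assume S: "invertible S"
  have e: "matrix_exp (s *\<^sub>R ((-2) *\<^sub>R mat 1) :: real^2^2) = exp (- (2 * s)) *\<^sub>R mat 1" for s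
    using matrix_exp_scaled_identity[of "- (2 * s)", where 'n=2] by (simp add: mult.commute)
  have "((\<lambda>s. exp (- (4 * s)) *\<^sub>R (S ** transpose S)) has_integral (1 / 4) *\<^sub>R (S ** transpose S)) {0..}"
    by (rule has_integral_exp_scaled) simp
  moreover have "matrix_exp (s *\<^sub>R ((-2) *\<^sub>R mat 1)) ** S ** transpose S
      ** matrix_exp (s *\<^sub>R transpose ((-2) *\<^sub>R mat 1)) = exp (- (4 * s)) *\<^sub>R (S ** transpose S)" for s
    unfolding transpose_scalar transpose_mat e
    by (simp add: matrix_scalar_ac scalar_matrix_assoc[symmetric] exp_add[symmetric])
  moreover have "posdef ((1 / 4) *\<^sub>R (S ** transpose S))"
    unfolding posdef_def
  proof (intro conjI allI impI)
    show "transpose ((1 / 4) *\<^sub>R (S ** transpose S)) = (1 / 4) *\<^sub>R (S ** transpose S)"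
      by (simp add: transpose_scalar matrix_transpose_mul)
    fix x :: "real^2" assume x: "x \<noteq> 0"
    have "inj ((*v) (transpose S))"
      using S by (simp add: inj_matrix_vector_mult transpose_invertible)
    then have "transpose S *v x \<noteq> 0"
      using x by (metis injD matrix_vector_mult_0_right)
    moreover have "x \<bullet> ((S ** transpose S) *v x) = (transpose S *v x) \<bullet> (transpose S *v x)"
      using inner_matrix_vector_mult_transpose[of x S "transpose S *v x"]
      by (simp add: matrix_vector_mul_assoc del: transpose_matrix_vector)
    ultimately show "0 < x \<bullet> (((1 / 4) *\<^sub>R (S ** transpose S)) *v x)"
      by (simp add: scaleR_matrix_vector_assoc[symmetric] del: transpose_matrix_vector)
  qed
  ultimately show "controllable ((-2) *\<^sub>R mat 1) S"
    unfolding controllable_def by (simp only: has_integral_integrable integral_unique)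
qed

section \<open>Stability, suboptimality and stationary covariance of the critical filter\<close>

lemma vector2_nth:
  "vector [a, b] $ (1::2) = (a::'a::zero)" "vector [a, b] $ (2::2) = (b::'a::zero)"
  by (simp_all add: vector_def)

lemma block_matrix_nth:
  "block_matrix P Q R S $ Inl i $ Inl k = P $ i $ k" "block_matrix P Q R S $ Inl i $ Inr l = Q $ i $ l"
  "block_matrix P Q R S $ Inr j $ Inl k = R $ j $ k" "block_matrix P Q R S $ Inr j $ Inr l = S $ j $ l"
  by (simp_all add: block_matrix_def)

lemmas matrix_entries = split_sum_all forall_2 sum_UNIV_Plus sum_2 block_matrix_nth vector2_nth
  matrix_matrix_mult_def matrix_vector_mult_def transpose_def mat_def

text \<open>Completing the square after multiplication by the positive upper left entry.\<close>

lemma posdef_2x2: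
  fixes X :: "real^2^2"
  assumes "X $ 1 $ 2 = X $ 2 $ 1" "X $ 1 $ 1 > 0" "X $ 1 $ 1 * X $ 2 $ 2 > (X $ 1 $ 2)\<^sup>2"
  shows "posdef X"
proof -
  have "0 < x \<bullet> (X *v x)" if "x \<noteq> 0" for x
  proof -
    let ?a = "X $ 1 $ 1" and ?b = "X $ 1 $ 2" and ?d = "X $ 2 $ 2"
    have "?a * (x \<bullet> (X *v x)) = (?a * x $ 1 + ?b * x $ 2)\<^sup>2 + (?a * ?d - ?b\<^sup>2) * (x $ 2)\<^sup>2"
      using assms(1) by (simp add: inner_vec_def sum_2 matrix_vector_mult_def power2_eq_square algebra_simps)
    also have "\<dots> > 0"
    proof (cases "x $ 2 = 0")
      case True
      with that have "x $ 1 \<noteq> 0" by (auto simp: vec_eq_iff forall_2)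
      with True assms(2) show ?thesis by simp
    next
      case False
      with assms(3) show ?thesis by (intro add_nonneg_pos mult_pos_pos) auto
    qed
    finally show ?thesis
      using assms(2) by (simp add: zero_less_mult_iff)
  qed
  moreover have "transpose X = X"
    using assms(1) by (simp add: vec_eq_iff forall_2 transpose_def)
  ultimately show ?thesis by (simp add: posdef_def)
qed

text \<open>The matrix is lower triangular with diagonal -2, -\<gamma>; which of the two is the
  eigenvalue depends on whether the first entry of the eigenvector vanishes.\<close>

lemma K_bad_stab:
  assumes "\<gamma> > 0"
  shows "K_bad \<gamma> \<in> K_stab"
proof -
  let ?A = "vector [vector [- 2, 0], vector [\<gamma>, - \<gamma>]] :: real^2^2"
  have "Re \<mu> < 0" if \<mu>: "complex_eigenvalue ?A \<mu>" for \<mu>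
  proof -
    obtain z :: "complex^2" where z: "z \<noteq> 0" "map_matrix complex_of_real ?A *v z = \<mu> *s z"
      using \<mu> unfolding complex_eigenvalue_def by blast
    have e: "- 2 * z $ 1 = \<mu> * z $ 1" "of_real \<gamma> * z $ 1 - of_real \<gamma> * z $ 2 = \<mu> * z $ 2"
      using z(2) by (simp_all add: vec_eq_iff forall_2 matrix_vector_mult_def sum_2 map_matrix_def vector2_nth)
    show ?thesis
    proof (cases "z $ 1 = 0")
      case True
      with z(1) have "z $ 2 \<noteq> 0" by (auto simp: vec_eq_iff forall_2)
      moreover have "- of_real \<gamma> * z $ 2 = \<mu> * z $ 2" using e(2) True by simp
      ultimately have "\<mu> = - of_real \<gamma>" by (metis mult_right_cancel)
      then show ?thesis using assms by simp
    next
      case False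
      with e(1) have "\<mu> = - 2" by (metis mult_right_cancel)
      then show ?thesis by simp
    qed
  qed
  then show ?thesis by (simp add: K_stab_def K_bad_def hurwitz_def)
qed

text \<open>Every optimal drift is -2 I, whereas \<open>K_bad \<gamma>\<close> has the off-diagonal
  entry \<gamma>.\<close>

lemma K_bad_not_opt: "\<gamma> > 0 \<Longrightarrow> K_bad \<gamma> \<notin> K_opt I_bad"
  by (auto simp: K_opt_I_bad K_bad_def vec_eq_iff forall_2 vector2_nth mat_def)

text \<open>The weight \<gamma> on the lag coordinate d makes its dissipation \<gamma>^2 d^2, which
  dominates the coupling \<gamma> c d for every \<gamma> > 0; with weight 1 it would be only
  \<gamma> d^2, too weak for large \<gamma>.\<close>

lemma lyapunov_form_K_bad:
  assumes \<gamma>: "\<gamma> > 0"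
  shows "lyapunov_form (block_matrix (mat 1) 0 0 (vector [vector [1, 0], vector [0, \<gamma>]]))
    (A_cl I_bad (K_bad \<gamma>))" (is "lyapunov_form ?D ?F")
  unfolding lyapunov_form_def
proof (intro conjI exI allI)
  show "transpose ?D = ?D"
    by (simp add: vec_eq_iff matrix_entries)
  show "min 1 \<gamma> > 0" "min (1 / 2) (\<gamma>\<^sup>2 / 2) > 0"
    using \<gamma> by simp_all
  fix p :: "real^(2 + 2)"
  define a b c d where "a = p $ Inl 1" and "b = p $ Inl 2" and "c = p $ Inr 1" and "d = p $ Inr 2"
  note abcd = a_def[symmetric] b_def[symmetric] c_def[symmetric] d_def[symmetric]
  have pp: "p \<bullet> p = a\<^sup>2 + b\<^sup>2 + c\<^sup>2 + d\<^sup>2"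
    by (simp add: inner_vec_def sum_UNIV_Plus sum_2 abcd power2_eq_square)
  have "p \<bullet> (?D *v p) = a\<^sup>2 + b\<^sup>2 + c\<^sup>2 + \<gamma> * d\<^sup>2"
    by (simp add: inner_vec_def matrix_entries abcd power2_eq_square)
  moreover have "min 1 \<gamma> * a\<^sup>2 \<le> 1 * a\<^sup>2" "min 1 \<gamma> * b\<^sup>2 \<le> 1 * b\<^sup>2" "min 1 \<gamma> * c\<^sup>2 \<le> 1 * c\<^sup>2" "min 1 \<gamma> * d\<^sup>2 \<le> \<gamma> * d\<^sup>2"
    by (intro mult_right_mono; simp)+
  ultimately show "min 1 \<gamma> * (p \<bullet> p) \<le> p \<bullet> (?D *v p)"
    by (simp add: pp distrib_left)
  have "p \<bullet> ((?D ** transpose ?F) *v p) = p \<bullet> (?D *v (transpose ?F *v p))"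
    by (simp add: matrix_vector_mul_assoc del: transpose_matrix_vector)
  also have "\<dots> = - a\<^sup>2 + a * c - b\<^sup>2 - 2 * c\<^sup>2 + \<gamma> * c * d - \<gamma>\<^sup>2 * d\<^sup>2"
    by (simp add: inner_vec_def matrix_entries abcd power2_eq_square A_cl_def I_bad_def K_bad_def algebra_simps
        del: transpose_matrix_vector)
  finally have F: "p \<bullet> ((?D ** transpose ?F) *v p) = \<dots>" .
  \<comment> \<open>The two mixed terms use up half of a^2, half of \<gamma>^2 d^2 and one of the
    two c^2, which leaves the constant min (1 / 2) (\<gamma>^2 / 2).\<close>
  have "2 * (a * c) \<le> a\<^sup>2 + c\<^sup>2" "2 * (\<gamma> * c * d) \<le> c\<^sup>2 + \<gamma>\<^sup>2 * d\<^sup>2"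
    using zero_le_power2[of "a - c"] zero_le_power2[of "c - \<gamma> * d"]
    by (simp_all add: power2_diff power_mult_distrib mult_ac)
  then have "p \<bullet> ((?D ** transpose ?F) *v p) \<le> - (1 / 2 * a\<^sup>2 + 1 / 2 * b\<^sup>2 + 1 / 2 * c\<^sup>2 + \<gamma>\<^sup>2 / 2 * d\<^sup>2)"
    unfolding F using zero_le_power2[of b] zero_le_power2[of c]
    by linarith
  moreover have "min (1 / 2) (\<gamma>\<^sup>2 / 2) * a\<^sup>2 \<le> 1 / 2 * a\<^sup>2" "min (1 / 2) (\<gamma>\<^sup>2 / 2) * b\<^sup>2 \<le> 1 / 2 * b\<^sup>2"
    "min (1 / 2) (\<gamma>\<^sup>2 / 2) * c\<^sup>2 \<le> 1 / 2 * c\<^sup>2" "min (1 / 2) (\<gamma>\<^sup>2 / 2) * d\<^sup>2 \<le> \<gamma>\<^sup>2 / 2 * d\<^sup>2"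
    by (intro mult_right_mono; simp)+
  ultimately show "p \<bullet> ((?D ** transpose ?F) *v p) \<le> - min (1 / 2) (\<gamma>\<^sup>2 / 2) * (p \<bullet> p)"
    unfolding pp by (simp add: distrib_left del: min_less_iff_conj)
qed

text \<open>The stationary covariance q of x1 and z2: its Lyapunov entry is (1 + \<gamma>) q =
  \<gamma> s, where s = 1 / 2 is the covariance of x1 and z1.\<close>

definition cov_bad :: "real \<Rightarrow> real" where
  "cov_bad \<gamma> = \<gamma> / (2 * (1 + \<gamma>))"

lemma cov_bad:
  assumes "\<gamma> > 0"
  shows "\<gamma> * cov_bad \<gamma> = \<gamma> / 2 - cov_bad \<gamma>" "0 < cov_bad \<gamma>" "cov_bad \<gamma> < 1 / 2"
  using assms by (simp_all add: cov_bad_def field_simps)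

text \<open>The first rows of the upper right and lower right blocks agree because the optimal error
  x1 - z1 is orthogonal to both filter states. The zero row says that x2 is uncorrelated with the
  filter; it is what makes \<open>Sigma12\<close> singular.\<close>

definition S_bad :: "real \<Rightarrow> real^(2 + 2)^(2 + 2)" where
  "S_bad \<gamma> = block_matrix ((3 / 2) *\<^sub>R mat 1) (vector [vector [1 / 2, cov_bad \<gamma>], vector [0, 0]])
     (vector [vector [1 / 2, 0], vector [cov_bad \<gamma>, 0]])
     (vector [vector [1 / 2, cov_bad \<gamma>], vector [cov_bad \<gamma>, cov_bad \<gamma>]])"

lemma S_bad_lyapunov:
  assumes "\<gamma> > 0"
  shows "A_cl I_bad (K_bad \<gamma>) ** S_bad \<gamma> + S_bad \<gamma> ** transpose (A_cl I_bad (K_bad \<gamma>)) + W_cl I_bad (K_bad \<gamma>) = 0"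
  using cov_bad(1)[OF assms]
  by (simp add: vec_eq_iff matrix_entries A_cl_def W_cl_def I_bad_def K_bad_def S_bad_def algebra_simps)

lemma Sigma_cov_K_bad: "\<gamma> > 0 \<Longrightarrow> Sigma_cov I_bad (K_bad \<gamma>) = S_bad \<gamma>"
  by (rule Sigma_cov_eq(2)[OF lyapunov_form_K_bad S_bad_lyapunov])

lemma K_bad_ctrb:
  assumes "\<gamma> > 0"
  shows "K_bad \<gamma> \<in> K_ctrb I_bad"
proof -
  have "posdef (Sigma22 I_bad (K_bad \<gamma>))"
  proof (rule posdef_2x2)
    \<comment> \<open>The determinant is q (1 / 2 - q) with q = \<open>cov_bad \<gamma>\<close>,
      positive since 0 < q < 1 / 2.\<close>
    show "Sigma22 I_bad (K_bad \<gamma>) $ 1 $ 1 * Sigma22 I_bad (K_bad \<gamma>) $ 2 $ 2 > (Sigma22 I_bad (K_bad \<gamma>) $ 1 $ 2)\<^sup>2"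
      using mult_strict_left_mono[OF cov_bad(3,2)[OF assms]]
      by (simp add: Sigma22_def block22_def Sigma_cov_K_bad[OF assms] S_bad_def matrix_entries power2_eq_square)
  qed (simp_all add: Sigma22_def block22_def Sigma_cov_K_bad[OF assms] S_bad_def matrix_entries)
  then show ?thesis using K_bad_stab[OF assms] by (simp add: K_ctrb_def)
qed

lemma Sigma12_K_bad_rank:
  assumes "\<gamma> > 0"
  shows "rank (Sigma12 I_bad (K_bad \<gamma>)) \<noteq> CARD(2)"
proof -
  have "det (Sigma12 I_bad (K_bad \<gamma>)) = 0"
    by (simp add: det_2 Sigma12_def block12_def Sigma_cov_K_bad[OF assms] S_bad_def matrix_entries)
  then have "\<not> invertible (Sigma12 I_bad (K_bad \<gamma>))"
    by (simp add: invertible_det_nz)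
  moreover have "invertible (Sigma12 I_bad (K_bad \<gamma>))"
    if "rank (Sigma12 I_bad (K_bad \<gamma>)) = CARD(2)"
    using that unfolding full_rank_injective matrix_left_invertible_injective[symmetric] invertible_left_inverse .
  ultimately show ?thesis by blast
qed

section \<open>Exact expansion of the loss and vanishing gradient\<close>

lemma tendsto_vector2:
  assumes "(f \<longlongrightarrow> a) L" "(g \<longlongrightarrow> b) L"
  shows "((\<lambda>x. vector [f x, g x] :: 'a::{topological_space,zero}^2) \<longlongrightarrow> vector [a, b]) L"
proof (rule vec_tendstoI)
  fix i :: 2
  show "((\<lambda>x. (vector [f x, g x] :: 'a^2) $ i) \<longlongrightarrow> vector [a, b] $ i) L"
    using assms exhaust_2[of i] by (auto simp: vector2_nth)
qed

text \<open>
  The entries with factor \<open>1 / 4\<close> come from the dual solution \<open>Q\<close>, whose only nonzero row in the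
  filter coordinates has entries \<open>- 1 / 4\<close> and \<open>1 / 4\<close> at \<open>x\<^sub>1\<close> and \<open>z\<^sub>1\<close>.  The quadratic terms are absorbed
  into the slope, so that \<open>loss_expansion\<close> is an exact identity and not a first-order expansion.
\<close>

definition loss_slope :: "real^(2 + 2)^(2 + 2) \<Rightarrow> (2, 2, 2) oe_filter \<Rightarrow> (2, 2, 2) oe_filter" where
  "loss_slope S K = (let s11 = S $ Inl 1 $ Inl 1; s12 = S $ Inl 1 $ Inl 2; s21 = S $ Inl 2 $ Inl 1;
       s13 = S $ Inl 1 $ Inr 1; s31 = S $ Inr 1 $ Inl 1; s14 = S $ Inl 1 $ Inr 2; s41 = S $ Inr 2 $ Inl 1;
       s23 = S $ Inl 2 $ Inr 1; s32 = S $ Inr 1 $ Inl 2; s24 = S $ Inl 2 $ Inr 2; s42 = S $ Inr 2 $ Inl 2;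
       s33 = S $ Inr 1 $ Inr 1; s34 = S $ Inr 1 $ Inr 2; s43 = S $ Inr 2 $ Inr 1; s44 = S $ Inr 2 $ Inr 2;
       B = fst (snd K); C = snd (snd K)
     in (vector [vector [(2 * s33 - s13 - s31) / 4, (s34 + s43 - s14 - s41) / 4], vector [0, 0]],
         vector [vector [(1 + B $ 1 $ 1 + s13 + s31 - 2 * s11) / 4, (B $ 1 $ 2 + s23 + s32 - s12 - s21) / 4],
                 vector [0, 0]],
         vector [vector [(C $ 1 $ 1 - 1) * s33 + C $ 1 $ 2 * (s34 + s43) - (s13 + s31 - 2 * s33),
                         C $ 1 $ 2 * s44 - (s14 + s41 - s34 - s43)],
                 vector [C $ 2 $ 1 * s33 + C $ 2 $ 2 * (s34 + s43) - (s23 + s32),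
                         C $ 2 $ 2 * s44 - (s24 + s42)]]))"

text \<open>The A and C parts vanish by the orthogonality of x1 - z1 and of x2 to the filter states;
  the first B entry is 1 + 1 + 1 / 2 + 1 / 2 - 2 * (3 / 2) = 0 up to the factor 1 / 4.\<close>

lemma loss_slope_K_bad: "loss_slope (S_bad \<gamma>) (K_bad \<gamma>) = 0"
  by (simp add: loss_slope_def K_bad_def S_bad_def matrix_entries zero_prod_def vec_eq_iff)

lemma tendsto_loss_slope:
  assumes "(S \<longlongrightarrow> S0) (nhds K0)"
  shows "((\<lambda>K. loss_slope (S K) K) \<longlongrightarrow> loss_slope S0 K0) (nhds K0)"
  unfolding loss_slope_def Let_def
  by (intro tendsto_Pair tendsto_vector2 tendsto_diff tendsto_add tendsto_mult tendsto_divide tendsto_const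
      tendsto_vec_nth tendsto_fst tendsto_snd filterlim_ident assms) simp_all

text \<open>Holds for every \<gamma>: the second row of the A part of the slope is zero, so the
  entries of \<open>K_bad \<gamma>\<close> that contain \<gamma> drop out. S is not assumed
  symmetric, which is why mirrored entries appear in pairs in the slope.\<close>

lemma loss_expansion:
  assumes S: "A_cl I_bad (A, B, C) ** S + S ** transpose (A_cl I_bad (A, B, C)) + W_cl I_bad (A, B, C) = 0"
  defines "c \<equiv> \<lambda>i. join_vec (sysG I_bad $ i) (- (C $ i))"
  shows "(\<Sum>i\<in>UNIV. c i \<bullet> (S *v c i)) - 5 / 2 = ((A, B, C) - K_bad \<gamma>) \<bullet> loss_slope S (A, B, C)"
proof -
  have E: "(A_cl I_bad (A, B, C) ** S + S ** transpose (A_cl I_bad (A, B, C)) + W_cl I_bad (A, B, C)) $ i $ j = 0" for i j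
    by (simp add: S)
  \<comment> \<open>Exactly the positions where Q is nonzero: x1 x1, x2 x2, x1 z1, z1 x1 and z1
    z1.\<close>
  note E = E[of "Inl 1" "Inl 1"] E[of "Inl 2" "Inl 2"] E[of "Inl 1" "Inr 1"] E[of "Inr 1" "Inl 1"] E[of "Inr 1" "Inr 1"]
  note E' = E[unfolded A_cl_def W_cl_def I_bad_def, simplified matrix_entries, simplified]
  have s: "S $ Inl 1 $ Inl 1 = 3 / 2" "S $ Inl 2 $ Inl 2 = 3 / 2"
    using E'(1,2) by (simp_all add: matrix_entries)
  show ?thesis
    using E'(3-5)
    by (simp add: c_def inner_vec_def matrix_entries I_bad_def K_bad_def loss_slope_def Let_def s)
      (simp add: algebra_simps diff_divide_distrib add_divide_distrib)
qed

theorem propositionF1: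
  fixes M :: "'w measure" and w v :: "real \<Rightarrow> 'w \<Rightarrow> real^2"
  assumes noise: "oe_noise I_bad M w v"
  shows "(\<forall>\<gamma>>0.
            (S1 I_bad \<and> S2 I_bad \<and> S3 I_bad \<and> S4 I_bad)
          \<and> K_bad \<gamma> \<in> K_stab
          \<and> GDERIV (oe_loss I_bad M w v) (K_bad \<gamma>) :> 0
          \<and> K_bad \<gamma> \<notin> K_opt I_bad
          \<and> K_bad \<gamma> \<in> K_ctrb I_bad
          \<and> rank (Sigma12 I_bad (K_bad \<gamma>)) \<noteq> CARD(2))
       \<and> (\<exists>c. (\<forall>\<gamma>>0. oe_loss I_bad M w v (K_bad \<gamma>) = c)
             \<and> \<not> compact (level_set I_bad M w v c))"
proof -
  let ?L = "oe_loss I_bad M w v"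
  have expansion: "?L K - 5 / 2 = (K - K_bad \<gamma>) \<bullet> loss_slope (Sigma_cov I_bad K) K"
    if D: "lyapunov_form D (A_cl I_bad K)" for D K \<gamma>
  proof -
    obtain A B C where K: "K = (A, B, C)" by (metis prod_cases3)
    show ?thesis
      using oe_loss_eq_trace[OF noise _ _ D[unfolded K] Sigma_cov_eq(1)[OF D[unfolded K]]]
        loss_expansion[OF Sigma_cov_eq(1)[OF D[unfolded K]], of \<gamma>] S3_I_bad
      by (simp add: K S3_def)
  qed
  \<comment> \<open>The increment in \<open>expansion\<close> is 0 at the filter itself, whatever
    the value of \<gamma>.\<close>
  have loss: "?L (K_bad \<gamma>) = 5 / 2" if "\<gamma> > 0" for \<gamma>
    using expansion[OF lyapunov_form_K_bad[OF that], of \<gamma>] by simp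
  have "GDERIV ?L (K_bad \<gamma>) :> 0" if \<gamma>: "\<gamma> > 0" for \<gamma>
  proof (rule GDERIV_zeroI)
    note D = lyapunov_form_K_bad[OF \<gamma>]
    \<comment> \<open>One fixed \<open>D\<close> certifies all filters in a neighbourhood, so
      \<open>expansion\<close> and the defining equation of \<open>Sigma_cov\<close> hold throughout
      it.\<close>
    have near: "\<forall>\<^sub>F K in nhds (K_bad \<gamma>).
        lyapunov_form (block_matrix (mat 1) 0 0 (vector [vector [1, 0], vector [0, \<gamma>]])) (A_cl I_bad K)"
      by (rule eventually_compose_filterlim[OF eventually_lyapunov_form[OF D] tendsto_A_cl])
    then show "\<forall>\<^sub>F K in nhds (K_bad \<gamma>). ?L K - ?L (K_bad \<gamma>)
        = (K - K_bad \<gamma>) \<bullet> loss_slope (Sigma_cov I_bad K) K"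
      by eventually_elim (simp add: loss[OF \<gamma>] expansion)
    have "(Sigma_cov I_bad \<longlongrightarrow> S_bad \<gamma>) (nhds (K_bad \<gamma>))"
      by (rule lyapunov_equation_solution_tendsto[OF D S_bad_lyapunov[OF \<gamma>] tendsto_A_cl tendsto_W_cl
            eventually_mono[OF near Sigma_cov_eq(1)]])
    from tendsto_loss_slope[OF this]
    show "((\<lambda>K. loss_slope (Sigma_cov I_bad K) K) \<longlongrightarrow> 0) (nhds (K_bad \<gamma>))"
      by (simp add: loss_slope_K_bad)
  qed
  moreover have "\<not> compact (level_set I_bad M w v (5 / 2))"
  proof
    assume "compact (level_set I_bad M w v (5 / 2))"
    then have "bounded (level_set I_bad M w v (5 / 2))"
      by (rule compact_imp_bounded)
    then obtain b where b: "norm K \<le> b" if "K \<in> level_set I_bad M w v (5 / 2)" for K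
      unfolding bounded_iff by blast
    \<comment> \<open>\<gamma> is itself an entry of the filter, so this filter lies in the level
      set but has norm greater than b.\<close>
    define \<gamma> where "\<gamma> = \<bar>b\<bar> + 1"
    have \<gamma>: "\<gamma> > 0" by (simp add: \<gamma>_def)
    have "K_bad \<gamma> \<in> level_set I_bad M w v (5 / 2)"
      using K_bad_stab[OF \<gamma>] loss[OF \<gamma>] by (simp add: level_set_def)
    then have "norm (K_bad \<gamma>) \<le> b" by (rule b)
    moreover have "\<bar>fst (K_bad \<gamma>) $ 2 $ 1\<bar> \<le> norm (K_bad \<gamma>)"
      using component_le_norm_cart[of "fst (K_bad \<gamma>) $ 2" 1]
        Finite_Cartesian_Product.norm_nth_le[of "fst (K_bad \<gamma>)" 2] norm_fst_le[of "fst (K_bad \<gamma>)" "snd (K_bad \<gamma>)"]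
      by simp
    ultimately show False
      by (simp add: K_bad_def vector2_nth \<gamma>_def)
  qed
  ultimately show ?thesis
    by (intro conjI allI impI exI[of _ "5 / 2"])
      (simp_all only: S1_I_bad S2_I_bad S3_I_bad S4_I_bad K_bad_stab K_bad_not_opt K_bad_ctrb
        Sigma12_K_bad_rank loss not_False_eq_True)
qed

end
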